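(* Let $n,k$ be positive integers. (1) If $n\geq 2$ is even and $0\leq k\leq n-1$, then $s(n,k)=\frac{nk}{2}$. (2) If $n\geq 5$ is odd and $4\leq k\leq 2n-6$, then $$\frac{n(n-1)k}{4n-6}\leq s(n,k)\leq \min\left\{\left\lceil\frac{k}{3}\right\rceil,\frac{n-1}{2}\right\}n.$$ Moreover, if in addition $n\geq 13$ (and $n$ is odd), then $s(n,2n-3)=\frac{n(n-1)}{2}$, $s(n,2n-4)=\frac{n(n-1)}{2}-1$, $s(n,2n-5)=\frac{n(n-1)}{2}-\frac{n-1}{2}$, $s(n,0)=0$, $s(n,1)=\frac{n-1}{2}$, $s(n,2)=n-1$, and $s(n,3)=n$.
   Context: All graphs are finite, simple and undirected. A perfect matching is a set of edges covering every vertex exactly once; an almost-perfect matching is a set of edges covering every vertex except one exactly once and missing the remaining vertex. The matching preclusion number $\mathrm{mp}(G)$ is the minimum number of edges whose deletion leaves a graph with neither a perfect matching nor an almost-perfect matching ($\mathrm{mp}(G)=0$ if $G$ has neither). For integers $n,k$, let $\mathscr{G}(n,k)$ be the set of all graphs on $n$ vertices with $\mathrm{mp}(G)=k$, and $s(n,k)=\min\{|E(G)|: G\in\mathscr{G}(n,k)\}$. *)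

theory Defs
  imports Complex_Main "HOL-Library.Ramsey"
begin

(* A graph is given by its vertex set V and its edge set E, a set of two-element subsets of V. *)
definition simple_graph :: "'a set \<Rightarrow> 'a set set \<Rightarrow> bool" where
  "simple_graph V E \<longleftrightarrow> finite V \<and> E \<subseteq> [V]\<^bsup>2\<^esup>"

definition perfect_matching :: "'a set \<Rightarrow> 'a set set \<Rightarrow> 'a set set \<Rightarrow> bool" where
  "perfect_matching V E M \<longleftrightarrow> M \<subseteq> E \<and> (\<forall>v\<in>V. \<exists>!e. e \<in> M \<and> v \<in> e)"

definition almost_perfect_matching :: "'a set \<Rightarrow> 'a set set \<Rightarrow> 'a set set \<Rightarrow> bool" where
  "almost_perfect_matching V E M \<longleftrightarrow>
     M \<subseteq> E \<and> (\<exists>u\<in>V. (\<forall>v\<in>V - {u}. \<exists>!e. e \<in> M \<and> v \<in> e) \<and> (\<forall>e\<in>M. u \<notin> e))"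

definition precluded :: "'a set \<Rightarrow> 'a set set \<Rightarrow> bool" where
  "precluded V E \<longleftrightarrow> \<not> (\<exists>M. perfect_matching V E M) \<and> \<not> (\<exists>M. almost_perfect_matching V E M)"

(* The convention mp(G) = 0 for a graph G with neither kind of matching is the case F = {}.
   With at least two vertices, F = E always qualifies, so the minimum exists; with at most one
   vertex no F does, and the value is unspecified. *)
definition mp :: "'a set \<Rightarrow> 'a set set \<Rightarrow> nat" where
  "mp V E = (LEAST m. \<exists>F. F \<subseteq> E \<and> card F = m \<and> precluded V (E - F))"

(* Natural numbers serve as vertex names; every finite graph has such a copy. *)
definition graphs_mp :: "nat \<Rightarrow> nat \<Rightarrow> (nat set \<times> nat set set) set" where
  "graphs_mp n k = {(V, E). simple_graph V E \<and> card V = n \<and> mp V E = k}"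

(* Unspecified, rather than 0, when graphs_mp n k is empty: evaluating or bounding min_size n k
   therefore requires exhibiting a graph. *)
definition min_size :: "nat \<Rightarrow> nat \<Rightarrow> nat" where
  "min_size n k = (LEAST m. \<exists>V E. (V, E) \<in> graphs_mp n k \<and> card E = m)"

end

theory Submission
  imports Defs "HOL-Library.Disjoint_Sets"
begin

text \<open>A set of edges precludes iff it leaves no matching of at least (n - 1)/2 edges. Isolating one
  vertex (n even) or two vertices (n odd) precludes, so mp bounds the degrees, or the sums of two
  degrees, from below, and with them the number of edges. Conversely mp is superadditive over
  edge-disjoint unions, and it can be lowered one by one by deleting edges, so a graph of given mp
  is found inside any graph of larger mp. Perfect matchings have mp at least 1 and odd Hamilton
  cycles have mp at least 3; the decompositions of the complete graph into these give the upper
  bounds. Near the top of the range one needs that the complete graph, or the complete graph minus a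
  matching, has mp at least 2n - 3, or 2n - 5: a maximum matching missing three vertices admits no
  augmenting path of length at most five, and the edges whose absence this forces are counted.\<close>

section \<open>Matching preclusion\<close>

text \<open>Isolating u and v costs deg u + deg v, less one if they are adjacent; summed over all
  pairs of vertices this counts each edge 2(n - 1) - 1 = 2n - 3 times, hence the denominator 4n - 6.
  In the complete graph the cost is 2n - 3, but its (n - 1)/2 Hamilton cycles certify only 3(n -
  1)/2, so the upper part of the range needs the matching argument. There, with n = 2m + 3 and a
  matching of m edges, the three missed vertices are pairwise non-adjacent, and four missing edges
  per matching edge would give exactly 3 + 4m = 2n - 3. The obstacle is a matching edge with one end
  joined to all missed vertices: it may lack only three. All m edges are of this kind when an
  independent set of m + 3 vertices is fully joined to a clique of m others; this graph lacks (m +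
  3)(m + 2)/2 edges, which for m = 1 and m = 2 is less than 3 + 4m. So such edges must be balanced
  against the missing edges between their other ends, and the count needs m at least 3; with a
  matching taken out beforehand it asks for m at least 5, that is n at least 13.\<close>

lemma simple_graph_finite: "simple_graph V E \<Longrightarrow> finite E"
  unfolding simple_graph_def by (meson finite_imp_finite_nsets finite_subset)

lemma simple_graph_subset: "simple_graph V E \<Longrightarrow> E' \<subseteq> E \<Longrightarrow> simple_graph V E'"
  unfolding simple_graph_def by blast

lemma card_complete: "finite V \<Longrightarrow> card ([V]\<^bsup>2\<^esup>) = card V * (card V - 1) div 2"
proof -
  assume "finite V"
  then have "[V]\<^bsup>2\<^esup> = {B. B \<subseteq> V \<and> card B = 2}"
    by (auto simp: nsets_def finite_subset)
  then show ?thesis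
    using n_subsets[OF \<open>finite V\<close>, of 2] by (simp add: choose_two)
qed

lemma card_Union_matching:
  assumes "disjoint M" "M \<subseteq> [V]\<^bsup>2\<^esup>"
  shows "card (\<Union>M) = 2 * card M"
proof -
  have "card (\<Union>M) = sum card M"
    using assms by (intro card_Union_disjoint) (auto simp: nsets_def)
  also have "\<dots> = (\<Sum>e\<in>M. 2)"
    using assms(2) by (intro sum.cong) (auto simp: nsets_def)
  finally show ?thesis by simp
qed

lemma matching_card_le:
  assumes "disjoint M" "M \<subseteq> [V]\<^bsup>2\<^esup>" "finite V"
  shows "2 * card M \<le> card V"
proof -
  have "\<Union>M \<subseteq> V" using assms(2) by (auto simp: nsets_def)
  with card_Union_matching[OF assms(1,2)] assms(3) show ?thesis
    by (metis card_mono)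
qed

text \<open>Both kinds of matching are those missing at most one vertex; the parity of n decides
  which kind occurs. Writing the size condition without division serves both parities at
  once.\<close>

lemma not_precluded_iff:
  assumes "simple_graph V E"
  shows "\<not> precluded V E \<longleftrightarrow> (\<exists>M\<subseteq>E. disjoint M \<and> card V \<le> 2 * card M + 1)"
proof
  have fin: "finite V" and sub: "E \<subseteq> [V]\<^bsup>2\<^esup>" using assms by (auto simp: simple_graph_def)
  \<comment> \<open>The covered set is a parameter W, to be used with V and with V minus the missed
    vertex.\<close>
  have unique: "disjoint M" if "M \<subseteq> E" "\<forall>v\<in>W. \<exists>!e. e \<in> M \<and> v \<in> e" "\<Union>M = W" for M W
  proof (rule disjointI)
    fix a b assume ab: "a \<in> M" "b \<in> M" "a \<noteq> b"
    show "a \<inter> b = {}"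
    proof (rule ccontr)
      assume "a \<inter> b \<noteq> {}"
      then obtain v where v: "v \<in> a" "v \<in> b" by blast
      then have "v \<in> W" using ab that(3) by blast
      with that(2) ab v show False by blast
    qed
  qed
  {
    assume "\<not> precluded V E"
    then consider M where "perfect_matching V E M" | M where "almost_perfect_matching V E M"
      unfolding precluded_def by blast
    then show "\<exists>M\<subseteq>E. disjoint M \<and> card V \<le> 2 * card M + 1"
    proof cases
      case 1
      then have M: "M \<subseteq> E" "\<forall>v\<in>V. \<exists>!e. e \<in> M \<and> v \<in> e" by (auto simp: perfect_matching_def)
      then have UM: "\<Union>M = V" using sub by (fastforce simp: nsets_def)
      have "disjoint M" using unique[OF M UM] .
      moreover have "card V = 2 * card M"
        using card_Union_matching[OF \<open>disjoint M\<close>, of V] M sub UM by auto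
      ultimately show ?thesis using M(1) by (intro exI[of _ M]) auto
    next
      case 2
      then obtain u where M: "M \<subseteq> E" and u: "u \<in> V" "\<forall>v\<in>V - {u}. \<exists>!e. e \<in> M \<and> v \<in> e" "\<forall>e\<in>M. u \<notin> e"
        by (auto simp: almost_perfect_matching_def)
      have UM: "\<Union>M = V - {u}"
      proof
        show "\<Union>M \<subseteq> V - {u}" using sub M u(3) by (auto simp: nsets_def)
        show "V - {u} \<subseteq> \<Union>M" using u(2) by blast
      qed
      have "disjoint M" using unique[OF M u(2) UM] .
      moreover have "card (V - {u}) = 2 * card M"
        using card_Union_matching[OF \<open>disjoint M\<close>, of V] M sub UM by auto
      ultimately show ?thesis using M(1) u(1) fin
        by (intro exI[of _ M]) (auto simp: card_Diff_singleton_if)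
    qed
  }
  assume "\<exists>M\<subseteq>E. disjoint M \<and> card V \<le> 2 * card M + 1"
  then obtain M where M: "M \<subseteq> E" "disjoint M" "card V \<le> 2 * card M + 1" by blast
  have c: "card (\<Union>M) = 2 * card M" using card_Union_matching[of M V] M sub by blast
  have UV: "\<Union>M \<subseteq> V" using M(1) sub by (auto simp: nsets_def)
  have ex1: "\<exists>!e. e \<in> M \<and> v \<in> e" if "v \<in> \<Union>M" for v
    using that M(2) unfolding disjoint_def by blast
  have "card (V - \<Union>M) \<le> 1"
    using M(3) c UV fin by (simp add: card_Diff_subset finite_subset)
  then consider "V - \<Union>M = {}" | u where "V - \<Union>M = {u}"
    using fin by (metis One_nat_def card_0_eq card_1_singletonE finite_Diff le_Suc_eq le_zero_eq)
  then show "\<not> precluded V E"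
  proof cases
    case 1
    then have "perfect_matching V E M"
      using M(1) ex1 unfolding perfect_matching_def by blast
    then show ?thesis by (auto simp: precluded_def)
  next
    case 2
    then have "\<forall>v\<in>V - {u}. \<exists>!e. e \<in> M \<and> v \<in> e" "u \<in> V" "\<forall>e\<in>M. u \<notin> e"
      using ex1 by blast+
    then have "almost_perfect_matching V E M"
      unfolding almost_perfect_matching_def using M(1) by blast
    then show ?thesis by (auto simp: precluded_def)
  qed
qed

lemma not_precludedI:
  assumes "simple_graph V E" "M \<subseteq> E" "disjoint M" "card V \<le> 2 * card M + 1"
  shows "\<not> precluded V E"
  using not_precluded_iff[OF assms(1)] assms(2-4) by blast

lemma precluded_antimono:
  assumes "precluded V E" "E' \<subseteq> E" "simple_graph V E"
  shows "precluded V E'"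
  using assms not_precluded_iff[OF assms(3)] not_precluded_iff[OF simple_graph_subset[OF assms(3,2)]]
  by (meson subset_trans)

lemma precluded_empty: "finite V \<Longrightarrow> card V \<ge> 2 \<Longrightarrow> precluded V {}"
  using not_precluded_iff[of V "{}"] by (auto simp: simple_graph_def)

section \<open>Elementary properties of mp\<close>

lemma mp_witness:
  assumes "simple_graph V E" "card V \<ge> 2"
  obtains F where "F \<subseteq> E" "card F = mp V E" "precluded V (E - F)"
proof -
  have "\<exists>m. \<exists>F. F \<subseteq> E \<and> card F = m \<and> precluded V (E - F)"
    using precluded_empty[of V] assms by (intro exI[of _ "card E"] exI[of _ E]) (auto simp: simple_graph_def)
  from LeastI_ex[OF this] show ?thesis using that unfolding mp_def by blast
qed

lemma mp_le: "F \<subseteq> E \<Longrightarrow> precluded V (E - F) \<Longrightarrow> mp V E \<le> card F"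
  unfolding mp_def by (rule Least_le) blast

lemma le_mpI:
  assumes "simple_graph V E" "card V \<ge> 2"
    and "\<And>F. F \<subseteq> E \<Longrightarrow> precluded V (E - F) \<Longrightarrow> k \<le> card F"
  shows "k \<le> mp V E"
  using mp_witness[OF assms(1,2)] assms(3) by metis

lemma mp_Diff_singleton_ge:
  assumes "simple_graph V E" "card V \<ge> 2"
  shows "mp V E \<le> mp V (E - {e}) + 1"
proof -
  obtain F where F: "F \<subseteq> E - {e}" "card F = mp V (E - {e})" "precluded V (E - {e} - F)"
    using mp_witness[OF simple_graph_subset[OF assms(1)] assms(2)] by (metis Diff_subset)
  \<comment> \<open>Intersecting with \<open>E\<close> covers the case that e is not an edge, where
    \<open>insert e F\<close> would not be a subset of \<open>E\<close>.\<close>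
  have "mp V E \<le> card (E \<inter> insert e F)"
  proof (rule mp_le)
    have "E - E \<inter> insert e F = E - {e} - F" by blast
    then show "precluded V (E - E \<inter> insert e F)" using F by simp
  qed auto
  also have "\<dots> \<le> card (insert e F)"
    using F(1) simple_graph_finite[OF assms(1)] by (intro card_mono) (auto intro: finite_subset)
  also have "\<dots> \<le> card F + 1" by (simp add: card_insert_le_m1)
  finally show ?thesis using F by simp
qed

lemma mp_empty: "finite V \<Longrightarrow> card V \<ge> 2 \<Longrightarrow> mp V {} = 0"
  using mp_le[of "{}" "{}" V] precluded_empty[of V] by simp

lemma mp_intermediate:
  assumes "simple_graph V E" "card V \<ge> 2" "k \<le> mp V E"
  shows "\<exists>E'\<subseteq>E. mp V E' = k"
proof -
  have "finite E" by (rule simple_graph_finite[OF assms(1)])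
  then show ?thesis using assms
  proof (induction E rule: finite_induct)
    case empty
    then show ?case using mp_empty[of V] by (auto simp: simple_graph_def)
  next
    case (insert e E)
    show ?case
    proof (cases "k = mp V (insert e E)")
      case False
      have "mp V (insert e E) \<le> mp V E + 1"
        using mp_Diff_singleton_ge[OF insert.prems(1,2), of e] insert.hyps by simp
      then have "k \<le> mp V E" using False insert.prems by simp
      then show ?thesis
        using insert.IH[OF simple_graph_subset[OF insert.prems(1)] insert.prems(2)] by blast
    qed blast
  qed
qed

text \<open>By antimonotonicity a set F that precludes the union also precludes each part, so
  \<open>F \<inter> E i\<close> has at least k edges; these pieces of F are disjoint.\<close>

lemma mp_UN_ge:
  assumes "simple_graph V (\<Union>i\<in>I. E i)" "card V \<ge> 2" "finite I"
    and "disjoint_family_on E I" "\<And>i. i \<in> I \<Longrightarrow> k \<le> mp V (E i)"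
  shows "card I * k \<le> mp V (\<Union>i\<in>I. E i)"
proof (rule le_mpI[OF assms(1,2)])
  fix F assume F: "F \<subseteq> (\<Union>i\<in>I. E i)" "precluded V ((\<Union>i\<in>I. E i) - F)"
  have finF: "finite F" using F(1) simple_graph_finite[OF assms(1)] finite_subset by blast
  have "k \<le> card (F \<inter> E i)" if "i \<in> I" for i
  proof -
    have "precluded V (E i - F \<inter> E i)"
      using F(2) by (rule precluded_antimono) (use that assms(1) in \<open>auto intro: simple_graph_subset\<close>)
    then have "mp V (E i) \<le> card (F \<inter> E i)" by (intro mp_le) auto
    with assms(5)[OF that] show ?thesis by simp
  qed
  then have "card I * k \<le> (\<Sum>i\<in>I. card (F \<inter> E i))"
    using sum_mono[of I "\<lambda>_. k" "\<lambda>i. card (F \<inter> E i)"] by simp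
  also have "\<dots> = card (\<Union>i\<in>I. F \<inter> E i)"
    using assms(3,4) finF by (subst card_UN_disjoint) (auto simp: disjoint_family_on_def)
  also have "\<dots> \<le> card F" using finF by (intro card_mono) auto
  finally show "card I * k \<le> card F" .
qed

text \<open>For an upper bound it suffices to exhibit a graph with mp at least k: some subgraph has
  mp exactly k and no more edges.\<close>

lemma min_size_le:
  assumes "simple_graph (V :: nat set) E" "card V = n" "n \<ge> 2" "k \<le> mp V E"
  shows "min_size n k \<le> card E"
proof -
  obtain E' where E': "E' \<subseteq> E" "mp V E' = k" using mp_intermediate[of V E k] assms by auto
  have "(V, E') \<in> graphs_mp n k"
    using E' assms simple_graph_subset by (auto simp: graphs_mp_def)
  then have "min_size n k \<le> card E'" unfolding min_size_def by (intro Least_le) blast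
  also have "\<dots> \<le> card E" using E' simple_graph_finite[OF assms(1)] by (intro card_mono)
  finally show ?thesis .
qed

text \<open>A \<open>LEAST\<close> says nothing about a minimiser until one candidate is known; the
  given graph supplies it through \<open>mp_intermediate\<close>.\<close>

lemma min_size_attained:
  assumes "simple_graph (V :: nat set) E" "card V = n" "n \<ge> 2" "k \<le> mp V E"
  obtains V' :: "nat set" and E' where "simple_graph V' E'" "card V' = n" "mp V' E' = k" "card E' = min_size n k"
proof -
  obtain E' where E': "E' \<subseteq> E" "mp V E' = k" using mp_intermediate[of V E k] assms by auto
  have "(V, E') \<in> graphs_mp n k"
    using E' assms simple_graph_subset by (auto simp: graphs_mp_def)
  then have "\<exists>m. \<exists>V E. (V, E) \<in> graphs_mp n k \<and> card E = m" by blast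
  from LeastI_ex[OF this] obtain V' E' where "(V', E') \<in> graphs_mp n k" "card E' = min_size n k"
    unfolding min_size_def by blast
  then show ?thesis using that[of V' E'] by (simp add: graphs_mp_def)
qed

section \<open>Degrees as upper bounds for mp\<close>

definition degree :: "'a set set \<Rightarrow> 'a \<Rightarrow> nat" where
  "degree E v = card {e \<in> E. v \<in> e}"

lemma sum_degree:
  assumes "simple_graph V E"
  shows "(\<Sum>v\<in>V. degree E v) = 2 * card E"
proof -
  have *: "finite V" "finite E" "E \<subseteq> [V]\<^bsup>2\<^esup>"
    using assms simple_graph_finite by (auto simp: simple_graph_def)
  have "(\<Sum>v\<in>V. card {e \<in> E. v \<in> e}) = 2 * card E"
  proof (rule sum_multicount[OF *(1,2)])
    show "\<forall>e\<in>E. card {v \<in> V. v \<in> e} = 2"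
    proof
      fix e assume "e \<in> E"
      then have "e \<subseteq> V" "card e = 2" using *(3) by (auto simp: nsets_def)
      moreover have "{v \<in> V. v \<in> e} = e" using \<open>e \<subseteq> V\<close> by blast
      ultimately show "card {v \<in> V. v \<in> e} = 2" by simp
    qed
  qed
  then show ?thesis by (simp add: degree_def)
qed

text \<open>A matching misses all of U. Two missed vertices are too many; if only one is forced and
  n is even, parity forces a second.\<close>

lemma precluded_isolated:
  assumes "simple_graph V E" "U \<subseteq> V" "\<And>e. e \<in> E \<Longrightarrow> e \<inter> U = {}"
    and "card U = 2 \<or> card U = 1 \<and> even (card V)"
  shows "precluded V E"
proof (rule ccontr)
  assume "\<not> precluded V E"
  then obtain M where M: "M \<subseteq> E" "disjoint M" "card V \<le> 2 * card M + 1"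
    using not_precluded_iff[OF assms(1)] by blast
  have fin: "finite V" using assms by (simp add: simple_graph_def)
  have "M \<subseteq> [V - U]\<^bsup>2\<^esup>"
  proof
    fix e assume "e \<in> M"
    then have "e \<in> [V]\<^bsup>2\<^esup>" "e \<inter> U = {}" using M(1) assms(1,3) by (auto simp: simple_graph_def)
    then show "e \<in> [V - U]\<^bsup>2\<^esup>" by (auto simp: nsets_def)
  qed
  then have "2 * card M \<le> card (V - U)" using M(2) fin by (intro matching_card_le) auto
  also have "\<dots> = card V - card U"
    using assms(2) fin by (intro card_Diff_subset) (auto intro: finite_subset)
  finally have "2 * card M \<le> card V - card U" .
  moreover have "card U \<le> card V" using assms(2) fin by (intro card_mono)
  ultimately show False using M(3) assms(4) by presburger
qed

lemma mp_le_degree: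
  assumes "simple_graph V E" "even (card V)" "v \<in> V"
  shows "mp V E \<le> degree E v"
  unfolding degree_def
proof (rule mp_le)
  show "precluded V (E - {e \<in> E. v \<in> e})"
    using assms by (intro precluded_isolated[of _ _ "{v}"]) (auto intro: simple_graph_subset[OF assms(1)])
qed auto

text \<open>The edges at u or v preclude once deleted. Inclusion-exclusion counts the edge between u
  and v once, which is the correction term on the left.\<close>

lemma mp_le_degree_pair:
  assumes "simple_graph V E" "u \<in> V" "v \<in> V" "u \<noteq> v"
  shows "mp V E + (if {u, v} \<in> E then 1 else 0) \<le> degree E u + degree E v"
proof -
  let ?F = "{e \<in> E. u \<in> e} \<union> {e \<in> E. v \<in> e}"
  have fin: "finite E" using simple_graph_finite[OF assms(1)] .
  have "mp V E \<le> card ?F"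
  proof (rule mp_le)
    show "precluded V (E - ?F)"
      using assms by (intro precluded_isolated[of _ _ "{u, v}"]) (auto intro: simple_graph_subset[OF assms(1)])
  qed auto
  moreover have "(if {u, v} \<in> E then 1 else 0) \<le> card ({e \<in> E. u \<in> e} \<inter> {e \<in> E. v \<in> e})"
  proof (cases "{u, v} \<in> E")
    case True
    then have "{{u, v}} \<subseteq> {e \<in> E. u \<in> e} \<inter> {e \<in> E. v \<in> e}" by blast
    then have "card {{u, v}} \<le> card ({e \<in> E. u \<in> e} \<inter> {e \<in> E. v \<in> e})"
      using fin by (intro card_mono) auto
    then show ?thesis using True by simp
  qed simp
  moreover have "card {e \<in> E. u \<in> e} + card {e \<in> E. v \<in> e} = card ?F + card ({e \<in> E. u \<in> e} \<inter> {e \<in> E. v \<in> e})"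
    using fin by (intro card_Un_Int) auto
  ultimately show ?thesis
    unfolding degree_def by linarith
qed

section \<open>Decompositions of complete graphs\<close>

lemma mod_add_left_cancel_nat:
  fixes a b i n :: nat
  assumes "(i + a) mod n = (i + b) mod n"
  shows "a mod n = b mod n"
proof (cases "a \<le> b")
  case True
  then show ?thesis
    using assms mod_eq_dvd_iff_nat[of "i + a" "i + b" n] mod_eq_dvd_iff_nat[of a b n] by simp
next
  case False
  then show ?thesis
    using assms mod_eq_dvd_iff_nat[of "i + b" "i + a" n] mod_eq_dvd_iff_nat[of b a n] by simp
qed

text \<open>Consecutive places of a sequence are paired off. Places start at 1 because place 0 is
  the vertex left uncovered when the sequence runs through an odd number of vertices.\<close>

lemma matching_of_inj:
  assumes "inj_on d {1..2 * q}" "d ` {1..2 * q} \<subseteq> V"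
  defines "M \<equiv> (\<lambda>s. {d (2 * s + 1), d (2 * s + 2)}) ` {..<q}"
  shows "disjoint M" "card M = q" "M \<subseteq> [V]\<^bsup>2\<^esup>"
proof -
  have eq: "d a = d b \<longleftrightarrow> a = b" if "a \<in> {1..2 * q}" "b \<in> {1..2 * q}" for a b
    using assms(1) that by (auto dest: inj_onD)
  have dis: "{d (2 * s + 1), d (2 * s + 2)} \<inter> {d (2 * t + 1), d (2 * t + 2)} = {}"
    if "s < q" "t < q" "s \<noteq> t" for s t
  proof -
    have "2 * s + 1 \<noteq> 2 * t + 2" "2 * s + 2 \<noteq> 2 * t + 1" by presburger+
    then show ?thesis using that by (auto simp: eq)
  qed
  show "disjoint M" unfolding M_def by (rule disjointI) (use dis in blast)
  have "inj_on (\<lambda>s. {d (2 * s + 1), d (2 * s + 2)}) {..<q}"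
    by (rule inj_onI) (use dis in blast)
  then show "card M = q" by (simp add: M_def card_image)
  have "d (2 * s + 1) \<noteq> d (2 * s + 2)" if "s < q" for s
    using that by (subst eq) auto
  moreover have "d (2 * s + 1) \<in> V" "d (2 * s + 2) \<in> V" if "s < q" for s
    using assms(2) that by auto
  ultimately show "M \<subseteq> [V]\<^bsup>2\<^esup>" unfolding M_def by auto
qed

lemma near_perfect_matching_exists:
  assumes "finite V" "card V = 2 * q + 1"
  obtains M where "disjoint M" "card M = q" "M \<subseteq> [V]\<^bsup>2\<^esup>"
proof -
  obtain d where d: "bij_betw d {0..<card V} V"
    using ex_bij_betw_nat_finite[OF assms(1)] by blast
  have "{1..2 * q} \<subseteq> {0..<card V}" using assms(2) by auto
  then have "inj_on d {1..2 * q}" "d ` {1..2 * q} \<subseteq> V"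
    using d unfolding bij_betw_def by (auto intro: inj_on_subset)
  from matching_of_inj[OF this] show ?thesis using that by blast
qed

section \<open>Hamilton cycles of odd length\<close>

definition cycle_edges :: "(nat \<Rightarrow> 'a) \<Rightarrow> nat \<Rightarrow> 'a set set" where
  "cycle_edges c n = (\<lambda>t. {c t, c (Suc t mod n)}) ` {..<n}"

lemma Suc_mod_neq: "2 \<le> n \<Longrightarrow> t < n \<Longrightarrow> Suc t mod n \<noteq> (t::nat)"
  by (auto simp: mod_Suc)

lemma cycle_edge_inj:
  assumes "inj_on c {..<n}" "n \<ge> 3"
  shows "inj_on (\<lambda>t. {c t, c (Suc t mod n)}) {..<n}"
proof (rule inj_onI)
  fix s t assume st: "s \<in> {..<n}" "t \<in> {..<n}" "{c s, c (Suc s mod n)} = {c t, c (Suc t mod n)}"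
  have lt: "Suc s mod n < n" "Suc t mod n < n" using assms(2) by auto
  have "c s = c t \<or> c s = c (Suc t mod n) \<and> c (Suc s mod n) = c t"
    using st(3) by (auto simp: doubleton_eq_iff)
  then have "s = t \<or> s = Suc t mod n \<and> Suc s mod n = t"
    using st(1,2) lt inj_onD[OF assms(1)] by (metis lessThan_iff)
  \<comment> \<open>In the second alternative two steps along the cycle return to the start, so n
    would divide 2.\<close>
  then show "s = t"
    using st(1,2) assms(2) by (auto simp: mod_Suc split: if_splits)
qed

lemma cycle_edges_simple:
  assumes "bij_betw c {..<n} V" "n \<ge> 3"
  shows "simple_graph V (cycle_edges c n)" "card (cycle_edges c n) = n"
proof -
  have inj: "inj_on c {..<n}" using assms(1) by (simp add: bij_betw_def)
  have "c t \<in> V" if "t < n" for t using assms(1) that by (auto simp: bij_betw_def)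
  moreover have "c t \<noteq> c (Suc t mod n)" if "t < n" for t
    using inj_onD[OF inj, of t "Suc t mod n"] Suc_mod_neq[of n t] that assms(2) by auto
  ultimately have "cycle_edges c n \<subseteq> [V]\<^bsup>2\<^esup>" using assms(2) by (auto simp: cycle_edges_def)
  moreover have "finite V" using assms(1) by (metis bij_betw_finite finite_lessThan)
  ultimately show "simple_graph V (cycle_edges c n)" by (simp add: simple_graph_def)
  show "card (cycle_edges c n) = n"
    unfolding cycle_edges_def using cycle_edge_inj[OF inj assms(2)] by (simp add: card_image)
qed

text \<open>The n near-perfect matchings of an odd cycle, n = 2q + 1, contain each edge only q times;
  as 2q < n, two edges cannot meet all of them.\<close>

lemma mp_odd_cycle_ge:
  assumes c: "bij_betw c {..<n} V" and n: "n = 2 * q + 1" "q \<ge> 1"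
  shows "3 \<le> mp V (cycle_edges c n)"
proof (rule le_mpI)
  let ?e = "\<lambda>t. {c t, c (Suc t mod n)}"
  have n3: "n \<ge> 3" using n by simp
  have inj: "inj_on c {..<n}" using c by (simp add: bij_betw_def)
  have cV: "card V = n" using bij_betw_same_card[OF c] by simp
  show sg: "simple_graph V (cycle_edges c n)" using cycle_edges_simple[OF c n3] by simp
  show "card V \<ge> 2" using cV n3 by simp
  fix F assume F: "F \<subseteq> cycle_edges c n" "precluded V (cycle_edges c n - F)"
  show "3 \<le> card F"
  proof (rule ccontr)
    assume "\<not> 3 \<le> card F"
    then have F2: "card F \<le> 2" by simp
    define J where "J = {t. t < n \<and> ?e t \<in> F}"
    have "finite F" using F(1) simple_graph_finite[OF sg] finite_subset by blast
    have "card (?e ` J) \<le> card F" using \<open>finite F\<close> by (intro card_mono) (auto simp: J_def)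
    moreover have "inj_on ?e J"
      using cycle_edge_inj[OF inj n3] by (rule inj_on_subset) (auto simp: J_def)
    ultimately have J2: "card J \<le> 2" using F2 by (simp add: card_image)
    have finJ: "finite J" by (simp add: J_def)
    \<comment> \<open>Leaving out the vertex at place i uses the edges at places i + 1, i + 3, ...,
      i + 2q - 1 modulo n. So edge t is used exactly for the i of the form t - (2s + 1) with s below
      q; the summand 2n prevents truncated subtraction.\<close>
    define bad where "bad = (\<Union>t\<in>J. (\<lambda>s. (t + 2 * n - (2 * s + 1)) mod n) ` {..<q})"
    have "card bad \<le> (\<Sum>t\<in>J. card ((\<lambda>s. (t + 2 * n - (2 * s + 1)) mod n) ` {..<q}))"
      unfolding bad_def by (rule card_UN_le[OF finJ])
    also have "\<dots> \<le> (\<Sum>t\<in>J. q)"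
      by (intro sum_mono) (metis card_image_le card_lessThan finite_lessThan)
    also have "\<dots> \<le> 2 * q" using J2 by simp
    finally have "card bad < card {..<n}" using n by simp
    then obtain i where i: "i < n" "i \<notin> bad"
      using card_mono[of bad "{..<n}"] finJ unfolding bad_def by (metis (no_types, lifting) finite_UN finite_imageI finite_lessThan lessThan_iff not_le subsetI)
    define d where "d = (\<lambda>o'. c ((i + o') mod n))"
    have injd: "inj_on d {1..2 * q}"
    proof (rule inj_onI)
      fix a b assume ab: "a \<in> {1..2 * q}" "b \<in> {1..2 * q}" "d a = d b"
      then have "(i + a) mod n = (i + b) mod n"
        using inj_onD[OF inj, of "(i + a) mod n" "(i + b) mod n"] n3 by (auto simp: d_def)
      then have "a mod n = b mod n" by (rule mod_add_left_cancel_nat)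
      then show "a = b" using ab n by simp
    qed
    have dV: "d ` {1..2 * q} \<subseteq> V" using c n3 by (auto simp: d_def bij_betw_def)
    have M: "disjoint ((\<lambda>s. {d (2 * s + 1), d (2 * s + 2)}) ` {..<q})"
      "card ((\<lambda>s. {d (2 * s + 1), d (2 * s + 2)}) ` {..<q}) = q"
      using matching_of_inj[OF injd dV] by simp_all
    have "{d (2 * s + 1), d (2 * s + 2)} \<in> cycle_edges c n - F" if s: "s < q" for s
    proof -
      let ?t = "(i + (2 * s + 1)) mod n"
      have e: "{d (2 * s + 1), d (2 * s + 2)} = ?e ?t"
        by (simp add: d_def mod_simps)
      have tn: "?t < n" using n3 by simp
      have "(?t + 2 * n - (2 * s + 1)) mod n = i"
      proof -
        have "(?t + 2 * n - (2 * s + 1)) mod n = (?t + (2 * n - (2 * s + 1))) mod n" using s n by simp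
        also have "\<dots> = (i + (2 * s + 1) + (2 * n - (2 * s + 1))) mod n" by (simp only: mod_simps)
        also have "\<dots> = (i + 2 * n) mod n" using s n by simp
        finally show ?thesis using i by simp
      qed
      then have "?t \<notin> J" using i(2) s unfolding bad_def by force
      then have "?e ?t \<notin> F" using tn by (auto simp: J_def)
      moreover have "?e ?t \<in> cycle_edges c n" using tn unfolding cycle_edges_def by blast
      ultimately show ?thesis using e by simp
    qed
    then have "\<not> precluded V (cycle_edges c n - F)"
      using M cV n by (intro not_precludedI[OF simple_graph_subset[OF sg]]) auto
    then show False using F(2) by simp
  qed
qed

text \<open>Walecki's cycles: the j-th one joins x and y below 2m when x + y is 2j or 2j + 1 modulo 2m,
  a zigzag path from j to j + m, which is closed up through the extra vertex 2m.\<close>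

definition zigzag :: "nat \<Rightarrow> nat \<Rightarrow> nat" where
  "zigzag m t = (if even t then 2 * m - t div 2 else (t + 1) div 2)"

definition walecki :: "nat \<Rightarrow> nat \<Rightarrow> nat \<Rightarrow> nat" where
  "walecki m j t = (if t < 2 * m then (j + zigzag m t) mod (2 * m) else 2 * m)"

lemma walecki_bij:
  assumes "m \<ge> 1"
  shows "bij_betw (walecki m j) {..<2 * m + 1} {..<2 * m + 1}"
proof -
  have "inj_on (walecki m j) {..<2 * m + 1}"
  proof (rule inj_onI)
    fix s t assume st: "s \<in> {..<2 * m + 1}" "t \<in> {..<2 * m + 1}" "walecki m j s = walecki m j t"
    have ne: "(j + zigzag m t) mod (2 * m) \<noteq> 2 * m" for t
      by (rule less_imp_neq, rule mod_less_divisor) (use assms in simp)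
    show "s = t"
    proof (cases "s < 2 * m \<and> t < 2 * m")
      case True
      then have "(j + zigzag m s) mod (2 * m) = (j + zigzag m t) mod (2 * m)"
        using st(3) by (simp add: walecki_def)
      \<comment> \<open>Numbers in 1..2m are determined by their residue modulo 2m.\<close>
      moreover have z: "zigzag m u \<in> {1..2 * m}" if "u < 2 * m" for u
        using that by (auto simp: zigzag_def)
      ultimately have "zigzag m s = zigzag m t"
      proof -
        have "(zigzag m s) mod (2 * m) = (zigzag m t) mod (2 * m)"
          using \<open>(j + zigzag m s) mod (2 * m) = (j + zigzag m t) mod (2 * m)\<close>
          by (rule mod_add_left_cancel_nat)
        then show ?thesis using z[of s] z[of t] True
          by (cases "zigzag m s = 2 * m"; cases "zigzag m t = 2 * m") simp_all
      qed
      then show ?thesis using True by (auto simp: zigzag_def split: if_splits elim!: evenE oddE)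
    next
      case False
      then show ?thesis using st ne[of s] ne[of t] ne[of s, symmetric] ne[of t, symmetric] by (auto simp: walecki_def split: if_splits)
    qed
  qed
  moreover have "walecki m j ` {..<2 * m + 1} \<subseteq> {..<2 * m + 1}"
  proof
    fix x assume "x \<in> walecki m j ` {..<2 * m + 1}"
    then obtain t where "x = walecki m j t" by blast
    moreover have "(j + zigzag m t) mod (2 * m) < 2 * m"
      by (rule mod_less_divisor) (use assms in simp)
    ultimately show "x \<in> {..<2 * m + 1}" by (simp add: walecki_def)
  qed
  ultimately show ?thesis
    unfolding bij_betw_def using endo_inj_surj[OF finite_lessThan] by blast
qed

text \<open>Modulo 2m the zigzag reads 0, 1, -1, 2, -2, ..., m, with 0, -1, -2, ... written as 2m,
  2m - 1, 2m - 2, ...; neighbouring terms therefore add up to 1 and 0 alternately.\<close>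

lemma zigzag_step:
  assumes "Suc t < 2 * m"
  shows "zigzag m t + zigzag m (Suc t) = (if even t then 2 * m + 1 else 2 * m)"
  using assms by (auto simp: zigzag_def elim!: evenE oddE)

text \<open>Recovers the index j of the cycle from an edge, so that different cycles are visibly
  disjoint. Away from the extra vertex 2m the ends add up to 2j or 2j + 1 modulo 2m; the two
  neighbours of 2m are j and j + m, both j modulo m.\<close>

definition walecki_key :: "nat \<Rightarrow> nat set \<Rightarrow> nat" where
  "walecki_key m e = (if 2 * m \<in> e then \<Sum>(e - {2 * m}) mod m else (\<Sum>e mod (2 * m)) div 2)"

lemma walecki_key_eq:
  assumes "j < m" "e \<in> cycle_edges (walecki m j) (2 * m + 1)"
  shows "walecki_key m e = j"
proof -
  obtain t where t: "t < 2 * m + 1" "e = {walecki m j t, walecki m j (Suc t mod (2 * m + 1))}"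
    using assms(2) by (auto simp: cycle_edges_def)
  have m: "m \<ge> 1" using assms(1) by simp
  have lt: "(j + zigzag m t) mod (2 * m) < 2 * m" for t using m by simp
  have neq: "walecki m j t \<noteq> walecki m j (Suc t mod (2 * m + 1))"
    using walecki_bij[OF m, of j] Suc_mod_neq[of "2 * m + 1" t] t(1) m
    by (metis (no_types, lifting) bij_betw_def inj_onD lessThan_iff mod_less_divisor zero_less_Suc Suc_eq_plus1 add_le_mono1 one_add_one mult_2 trans_le_add1)
  consider "Suc t < 2 * m" | "Suc t = 2 * m" | "t = 2 * m" using t(1) by linarith
  then show ?thesis
  proof cases
    case 1
    then have e: "e = {(j + zigzag m t) mod (2 * m), (j + zigzag m (Suc t)) mod (2 * m)}"
      using t by (simp add: walecki_def)
    \<comment> \<open>\<open>\<Sum>e\<close> is a sum over a set, so it equals the sum of the two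
      ends only if they differ.\<close>
    then have ne: "(j + zigzag m t) mod (2 * m) \<noteq> (j + zigzag m (Suc t)) mod (2 * m)"
      using neq 1 t by (simp add: walecki_def)
    have "\<Sum>e mod (2 * m) = (j + zigzag m t + (j + zigzag m (Suc t))) mod (2 * m)"
      using e ne by (simp add: mod_simps)
    also have "j + zigzag m t + (j + zigzag m (Suc t)) = 2 * j + (if even t then 1 else 0) + 2 * m"
      using zigzag_step[OF 1] by auto
    also have "\<dots> mod (2 * m) = 2 * j + (if even t then 1 else 0)"
      using assms(1) by simp
    finally have "\<Sum>e mod (2 * m) = 2 * j + (if even t then 1 else 0)" .
    moreover have "2 * m \<notin> e" using e less_not_refl3[OF lt[of t]] less_not_refl3[OF lt[of "Suc t"]] by simp
    ultimately show ?thesis by (simp add: walecki_key_def)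
  next
    case 2
    then have "zigzag m t = m" by (auto simp: zigzag_def elim!: oddE)
    then have "e = {(j + m) mod (2 * m), 2 * m}" using t 2 by (simp add: walecki_def)
    moreover have "(j + m) mod (2 * m) = j + m" using assms(1) by simp
    ultimately show ?thesis using assms(1) by (simp add: walecki_key_def insert_Diff_if)
  next
    case 3
    then have "e = {2 * m, (j + 2 * m) mod (2 * m)}" using t m by (simp add: walecki_def zigzag_def)
    moreover have "(j + 2 * m) mod (2 * m) = j" using assms(1) by simp
    ultimately show ?thesis using assms(1) by (simp add: walecki_key_def insert_Diff_if)
  qed
qed

lemma hamilton_union:
  assumes "m \<ge> 1" "r \<le> m"
  obtains E where "simple_graph {..<2 * m + 1} E" "card E = r * (2 * m + 1)" "3 * r \<le> mp {..<2 * m + 1} E"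
proof -
  let ?V = "{..<2 * m + 1}" and ?E = "\<lambda>j. cycle_edges (walecki m j) (2 * m + 1)"
  have n3: "2 * m + 1 \<ge> 3" using assms by simp
  have sg: "simple_graph ?V (?E j)" "card (?E j) = 2 * m + 1" for j
    using cycle_edges_simple[OF walecki_bij[OF assms(1)] n3] by auto
  have dis: "disjoint_family_on ?E {..<r}"
    unfolding disjoint_family_on_def using walecki_key_eq[of _ m] assms(2)
    by (metis disjoint_iff lessThan_iff less_le_trans)
  have sgU: "simple_graph ?V (\<Union>j\<in>{..<r}. ?E j)"
    using sg unfolding simple_graph_def by blast
  have "card (\<Union>j\<in>{..<r}. ?E j) = (\<Sum>j<r. card (?E j))"
    using dis simple_graph_finite[OF sg(1)]
    by (intro card_UN_disjoint) (auto simp: disjoint_family_on_def)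
  then have "card (\<Union>j\<in>{..<r}. ?E j) = r * (2 * m + 1)" using sg by simp
  moreover have "card {..<r} * 3 \<le> mp ?V (\<Union>j\<in>{..<r}. ?E j)"
    using sgU dis assms mp_odd_cycle_ge[OF walecki_bij[OF assms(1)], of m] n3
    by (intro mp_UN_ge) auto
  ultimately show ?thesis using that[of "\<Union>j\<in>{..<r}. ?E j"] sgU by simp
qed

section \<open>Perfect matchings that decompose the complete graph of even order\<close>

lemma matching_of_involution:
  assumes "\<And>v. v \<in> V \<Longrightarrow> f v \<in> V \<and> f v \<noteq> v \<and> f (f v) = v"
  defines "M \<equiv> (\<lambda>v. {v, f v}) ` V"
  shows "disjoint M" "M \<subseteq> [V]\<^bsup>2\<^esup>" "2 * card M = card V"
proof -
  show dis: "disjoint M"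
  proof (rule disjointI)
    fix a b assume "a \<in> M" "b \<in> M" "a \<noteq> b"
    then obtain u v where uv: "u \<in> V" "v \<in> V" "a = {u, f u}" "b = {v, f v}" "a \<noteq> b"
      unfolding M_def by blast
    have ff: "f (f u) = u" "f (f v) = v" using assms(1) uv by auto
    have "u \<noteq> v" using uv by blast
    moreover have "u \<noteq> f v"
    proof
      assume "u = f v"
      then have "a = b" using uv(3,4) ff(2) by (simp add: insert_commute)
      then show False using uv(5) by simp
    qed
    moreover have "f u \<noteq> v" using \<open>u \<noteq> f v\<close> ff(1) by metis
    moreover have "f u \<noteq> f v" using \<open>u \<noteq> v\<close> ff by metis
    ultimately show "a \<inter> b = {}" using uv by simp
  qed
  show sub: "M \<subseteq> [V]\<^bsup>2\<^esup>"
  proof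
    fix e assume "e \<in> M"
    then obtain v where "v \<in> V" "e = {v, f v}" unfolding M_def by blast
    then show "e \<in> [V]\<^bsup>2\<^esup>" using assms(1)[of v] by simp metis
  qed
  have "\<Union>M = V" using assms(1) by (auto simp: M_def)
  then show "2 * card M = card V" using card_Union_matching[OF dis sub] by simp
qed

text \<open>Vertices x and y below N = 2q + 1 are partners in the c-th perfect matching when x + y = c
  modulo N; the vertex c/2 modulo N is its own partner there and is matched to N instead.\<close>

definition partner :: "nat \<Rightarrow> nat \<Rightarrow> nat \<Rightarrow> nat" where
  "partner q c v = (let N = 2 * q + 1; y = (c + N - v) mod N in
     if v = N then c * (q + 1) mod N else if y = v then N else y)"

text \<open>q + 1 is the inverse of 2 modulo 2q + 1, because 2(q + 1) = (2q + 1) + 1.\<close>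

lemma half_mod:
  fixes c q :: nat
  shows "2 * (c * (q + 1) mod (2 * q + 1)) mod (2 * q + 1) = c mod (2 * q + 1)"
proof -
  have "2 * (c * (q + 1) mod (2 * q + 1)) mod (2 * q + 1) = 2 * (c * (q + 1)) mod (2 * q + 1)"
    by (simp only: mod_simps)
  also have "2 * (c * (q + 1)) = c + c * (2 * q + 1)" by (simp add: algebra_simps)
  also have "\<dots> mod (2 * q + 1) = c mod (2 * q + 1)" by (rule mod_mult_self1)
  finally show ?thesis .
qed

text \<open>Since 2 is invertible modulo the odd number N, the reflection taking x to c - x has
  exactly one fixed point h. That vertex is the one left over for N, and this description is all
  that is used of \<open>partner\<close> below.\<close>

lemma partner_cases:
  fixes c q v :: nat
  assumes c: "c < 2 * q + 1" and v: "v < 2 * q + 2"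
  obtains N h where "N = 2 * q + 1" "h < N" "2 * h mod N = c"
    "\<forall>u<N. (c + N - u) mod N = u \<longleftrightarrow> u = h"
    "\<forall>u. partner q c u = (if u = N then h else if u < N \<and> u = h then N else (c + N - u) mod N)"
    "v = N \<or> v = h \<or> v < N \<and> v \<noteq> h"
proof -
  define N where "N = 2 * q + 1"
  define h where "h = c * (q + 1) mod N"
  have cN: "c < N" using c by (simp add: N_def)
  have h: "h < N" "2 * h mod N = c" using half_mod[of c q] c by (simp_all add: h_def N_def)
  have iff: "(c + N - u) mod N = u \<longleftrightarrow> u = h" if u: "u < N" for u
  proof
    assume "(c + N - u) mod N = u"
    then have "(u + (c + N - u)) mod N = (u + u) mod N" by (metis mod_add_right_eq)
    then have "2 * u mod N = c mod N" using u by (simp add: mult_2)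
    then have "2 * u * (q + 1) mod N = c * (q + 1) mod N" by (metis mod_mult_left_eq)
    moreover have "2 * u * (q + 1) = u + u * N" by (simp add: N_def algebra_simps)
    ultimately have "(u + u * N) mod N = h" unfolding h_def by metis
    then show "u = h" using u by simp
  next
    assume "u = h"
    then have "(u + u) mod N = c" using h(2) by (simp add: mult_2)
    moreover have "u + (c + N - u) = c + N" using u by simp
    ultimately have "(u + (c + N - u)) mod N = (u + u) mod N"
      using cN by simp
    then have "(c + N - u) mod N = u mod N" by (rule mod_add_left_cancel_nat)
    then show "(c + N - u) mod N = u" using u by simp
  qed
  have partner: "partner q c u = (if u = N then h else if u < N \<and> u = h then N else (c + N - u) mod N)" for u
  proof (cases "u < N")
    case True
    then show ?thesis using iff[OF True] by (simp add: partner_def Let_def N_def)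
  next
    case False
    then have "(c + N - u) mod N \<noteq> u"
      using h(1) by (metis gr_implies_not0 mod_less_divisor neq0_conv)
    then show ?thesis using False by (simp add: partner_def Let_def h_def N_def)
  qed
  have "v = N \<or> v = h \<or> v < N \<and> v \<noteq> h" using v by (auto simp: N_def)
  with N_def h iff partner show ?thesis using that[of N h] by blast
qed

lemma partner_involution:
  assumes c: "c < 2 * q + 1" and v: "v < 2 * q + 2"
  shows "partner q c v < 2 * q + 2 \<and> partner q c v \<noteq> v \<and> partner q c (partner q c v) = v"
proof -
  obtain N h where N: "N = 2 * q + 1" and h: "h < N" "2 * h mod N = c"
    and iff: "\<forall>u<N. (c + N - u) mod N = u \<longleftrightarrow> u = h"
    and partner: "\<forall>u. partner q c u = (if u = N then h else if u < N \<and> u = h then N else (c + N - u) mod N)"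
    and "v = N \<or> v = h \<or> v < N \<and> v \<noteq> h"
    by (rule partner_cases[OF assms])
  then consider "v = N" | "v = h" | "v < N" "v \<noteq> h" by blast
  then have "partner q c v < N + 1 \<and> partner q c v \<noteq> v \<and> partner q c (partner q c v) = v"
  proof cases
    case 3
    define y where "y = (c + N - v) mod N"
    have yN: "y < N" unfolding y_def by (rule mod_less_divisor) (use h in simp)
    have yv: "y \<noteq> v" using iff[rule_format, OF 3(1)] 3(2) by (simp add: y_def)
    have "y + (c + N - y) = c + N - v + v" using yN 3(1) by linarith
    then have "(y + (c + N - y)) mod N = (c + N - v + v) mod N" by (rule arg_cong)
    also have "\<dots> = (y + v) mod N" by (simp only: y_def mod_simps)
    finally have "(c + N - y) mod N = v mod N" by (rule mod_add_left_cancel_nat)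
    then have yy: "(c + N - y) mod N = v" using 3(1) by simp
    then have "y \<noteq> h" using iff[rule_format, OF yN] yv by metis
    then show ?thesis using yN yv yy 3 by (simp add: partner y_def[symmetric])
  qed (use h in \<open>simp_all add: partner\<close>)
  then show ?thesis by (simp add: N)
qed

text \<open>Reads the index c off an edge: ordinary partners add up to c, while the partner h of N
  satisfies 2h = c, hence the doubling.\<close>

definition partner_key :: "nat \<Rightarrow> nat set \<Rightarrow> nat" where
  "partner_key q e = (if 2 * q + 1 \<in> e then 2 * \<Sum>(e - {2 * q + 1}) else \<Sum>e) mod (2 * q + 1)"

lemma partner_key_eq:
  assumes c: "c < 2 * q + 1" and v: "v < 2 * q + 2"
  shows "partner_key q {v, partner q c v} = c"
proof -
  obtain N h where N: "N = 2 * q + 1" and h: "h < N" "2 * h mod N = c"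
    and iff: "\<forall>u<N. (c + N - u) mod N = u \<longleftrightarrow> u = h"
    and partner: "\<forall>u. partner q c u = (if u = N then h else if u < N \<and> u = h then N else (c + N - u) mod N)"
    and "v = N \<or> v = h \<or> v < N \<and> v \<noteq> h"
    by (rule partner_cases[OF assms])
  from this(6) consider "v = N" | "v = h" | "v < N" "v \<noteq> h" by blast
  moreover have key: "partner_key q e = (if N \<in> e then 2 * \<Sum>(e - {N}) else \<Sum>e) mod N" for e
    by (simp add: partner_key_def N)
  ultimately show ?thesis
  proof cases
    case 3
    define y where "y = (c + N - v) mod N"
    have yN: "y < N" unfolding y_def by (rule mod_less_divisor) (use h in simp)
    have yv: "y \<noteq> v" using iff[rule_format, OF 3(1)] 3(2) by (simp add: y_def)
    have "(v + y) mod N = (v + (c + N - v)) mod N" by (simp only: y_def mod_simps)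
    moreover have "c < N" using c N by simp
    ultimately have "(v + y) mod N = c" using 3(1) by simp
    then show ?thesis using yN yv 3 by (simp add: key partner y_def[symmetric])
  qed (use h in \<open>simp_all add: key partner insert_Diff_if\<close>)
qed

lemma factor_union:
  assumes "k \<le> 2 * q + 1"
  obtains E where "simple_graph {..<2 * q + 2} E" "card E = k * (q + 1)" "k \<le> mp {..<2 * q + 2} E"
proof -
  let ?V = "{..<2 * q + 2}" and ?E = "\<lambda>c. (\<lambda>v. {v, partner q c v}) ` {..<2 * q + 2}"
  have inv: "partner q c v \<in> ?V \<and> partner q c v \<noteq> v \<and> partner q c (partner q c v) = v"
    if "c < k" "v \<in> ?V" for c v using partner_involution[of c q v] that assms by simp
  have dis: "disjoint (?E c)" and sg: "simple_graph ?V (?E c)" and cE: "card (?E c) = q + 1"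
    if "c < k" for c
    using matching_of_involution[of ?V "partner q c"] inv[OF that] by (simp_all add: simple_graph_def)
  have "1 \<le> mp ?V (?E c)" if "c < k" for c
  proof (rule le_mpI)
    fix F assume F: "F \<subseteq> ?E c" "precluded ?V (?E c - F)"
    have "\<not> precluded ?V (?E c)"
      using dis[OF that] sg[OF that] cE[OF that] by (intro not_precludedI[of _ _ "?E c"]) auto
    then have "F \<noteq> {}" using F(2) by auto
    then show "1 \<le> card F"
      using F(1) by (metis card_gt_0_iff finite_imageI finite_lessThan finite_subset Suc_leI One_nat_def)
  qed (use sg[OF that] in auto)
  moreover have fam: "disjoint_family_on ?E {..<k}"
    unfolding disjoint_family_on_def
  proof (intro ballI impI)
    fix c d assume cd: "c \<in> {..<k}" "d \<in> {..<k}" "c \<noteq> d"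
    have "partner_key q e = c" if "e \<in> ?E c" "c < k" for e c
      using that assms partner_key_eq[of c q] by auto
    then show "?E c \<inter> ?E d = {}" using cd by (metis (no_types, lifting) disjoint_iff lessThan_iff)
  qed
  moreover have sgU: "simple_graph ?V (\<Union>c\<in>{..<k}. ?E c)"
    using sg unfolding simple_graph_def by blast
  ultimately have "card {..<k} * 1 \<le> mp ?V (\<Union>c\<in>{..<k}. ?E c)"
    by (intro mp_UN_ge) auto
  moreover have "card (\<Union>c\<in>{..<k}. ?E c) = (\<Sum>c<k. card (?E c))"
    using fam by (intro card_UN_disjoint) (auto simp: disjoint_family_on_def)
  then have "card (\<Union>c\<in>{..<k}. ?E c) = k * (q + 1)" using cE by simp
  ultimately show ?thesis using that[of "\<Union>c\<in>{..<k}. ?E c"] sgU by simp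
qed

lemma min_size_even:
  assumes "n \<ge> 2" "even n" "k \<le> n - 1"
  shows "2 * min_size n k = n * k"
proof -
  obtain p where p: "n = 2 * p" using assms(2) by (rule evenE)
  define q where "q = p - 1"
  have n: "n = 2 * q + 2" using p assms(1) by (simp add: q_def)
  obtain E where E: "simple_graph {..<n} E" "card E = k * (q + 1)" "k \<le> mp {..<n} E"
    using factor_union[of k q] assms n by auto
  have "min_size n k \<le> k * (q + 1)"
    using min_size_le[OF E(1) _ assms(1) E(3)] E(2) by simp
  then have le: "2 * min_size n k \<le> n * k" using n by (simp add: algebra_simps)
  obtain V' :: "nat set" and E' where E': "simple_graph V' E'" "card V' = n" "mp V' E' = k" "card E' = min_size n k"
    using min_size_attained[OF E(1) _ assms(1) E(3)] by auto
  have "n * k = (\<Sum>v\<in>V'. k)" using E' by simp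
  also have "\<dots> \<le> (\<Sum>v\<in>V'. degree E' v)"
    using mp_le_degree[OF E'(1)] E' assms(2) by (intro sum_mono) auto
  also have "\<dots> = 2 * min_size n k" using sum_degree[OF E'(1)] E'(4) by simp
  finally show ?thesis using le by simp
qed

section \<open>Graphs with a maximum matching that misses three vertices\<close>

text \<open>Each edge of C gets a vertex of W lying on it, and edges of a matching cannot share one.
  This bounds how many counted missing edges the matching H can account for.\<close>

lemma card_matching_cover_le:
  assumes "finite W" "disjoint H" "\<And>e. e \<in> C \<Longrightarrow> e \<inter> W \<noteq> {}"
  shows "card (C \<inter> H) \<le> card W"
proof -
  have "\<forall>e\<in>C. \<exists>w. w \<in> e \<inter> W" using assms(3) by blast
  then obtain g where g: "\<forall>e\<in>C. g e \<in> e \<inter> W" by metis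
  have "inj_on g (C \<inter> H)"
  proof (rule inj_onI)
    fix e f assume ef: "e \<in> C \<inter> H" "f \<in> C \<inter> H" "g e = g f"
    then have "g e \<in> e \<inter> f" using g by fastforce
    then show "e = f" using disjointD[OF assms(2), of e f] ef by blast
  qed
  moreover have "g ` (C \<inter> H) \<subseteq> W" using g by blast
  ultimately show ?thesis using assms(1) card_inj_on_le by blast
qed

section \<open>Augmenting paths of length one, three and five\<close>

locale deficient_matching =
  fixes V :: "'a set" and G M :: "'a set set"
  assumes graph: "simple_graph V G" and precluded: "precluded V G"
    and matching: "disjoint M" "M \<subseteq> G" and card_V: "card V = 2 * card M + 3"
begin

definition U where "U = V - \<Union>M"

definition nb where "nb z = {u \<in> U. {u, z} \<in> G}"

definition cross where "cross e = {{p, q} | p q. p \<in> e \<and> q \<in> U} - G"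

lemma fin: "finite V" "finite G" "finite M" "finite U"
  using graph simple_graph_finite[OF graph] matching(2) finite_subset
  by (auto simp: simple_graph_def U_def)

lemma G_pairs: "G \<subseteq> [V]\<^bsup>2\<^esup>" "M \<subseteq> [V]\<^bsup>2\<^esup>"
  using graph matching by (auto simp: simple_graph_def)

lemma Union_M: "\<Union>M \<subseteq> V" "card (\<Union>M) = 2 * card M"
  using card_Union_matching[OF matching(1) G_pairs(2)] G_pairs(2) by (auto simp: nsets_def)

lemma card_U: "card U = 3"
  using Union_M card_V fin by (simp add: U_def card_Diff_subset finite_subset)

text \<open>Since T stays within the vertices of S and the uncovered ones, exchanging S for T in M
  yields a matching again. One edge more than M would leave a single vertex uncovered, against
  preclusion. All augmenting paths below are instances.\<close>

lemma no_augmentation: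
  assumes "S \<subseteq> M" "T \<subseteq> G" "disjoint T" "\<Union>T \<subseteq> \<Union>S \<union> U"
  shows "card T \<le> card S"
proof (rule ccontr)
  assume "\<not> card T \<le> card S"
  have "finite T" using assms(2) fin(2) by (rule finite_subset)
  have T: "e \<noteq> {}" if "e \<in> T" for e
    using that assms(2) G_pairs by (auto elim!: nsets2_E)
  have "e \<inter> f = {}" if "e \<in> M - S" "f \<in> S" for e f
    using that assms(1) by (intro disjointD[OF matching(1)]) auto
  then have "\<Union>(M - S) \<inter> \<Union>S = {}" by blast
  moreover have "\<Union>(M - S) \<inter> U = {}" by (auto simp: U_def)
  ultimately have sep: "\<Union>(M - S) \<inter> \<Union>T = {}" using assms(4) by blast
  have "disjoint (M - S)" using matching(1) by (auto simp: disjoint_def)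
  then have "disjoint ((M - S) \<union> T)" by (rule disjoint_union[OF _ assms(3) sep])
  \<comment> \<open>The two families share no vertex; as edges are non-empty they share no edge
    either, so the cardinalities add.\<close>
  moreover have "(M - S) \<inter> T = {}"
  proof (rule ccontr)
    assume "(M - S) \<inter> T \<noteq> {}"
    then obtain e where e: "e \<in> M - S" "e \<in> T" by blast
    then obtain z where "z \<in> e" using T by blast
    then have "z \<in> \<Union>(M - S) \<inter> \<Union>T" using e by blast
    then show False using sep by simp
  qed
  then have "card ((M - S) \<union> T) = card M - card S + card T"
    using fin \<open>finite T\<close> assms(1) by (simp add: card_Un_disjoint card_Diff_subset finite_subset)
  moreover have "card S \<le> card M" using assms(1) fin by (intro card_mono)
  ultimately have "\<not> precluded V G"
    using graph matching(2) assms(2) card_V \<open>\<not> card T \<le> card S\<close>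
    by (intro not_precludedI[of _ _ "(M - S) \<union> T"]) auto
  then show False using precluded by simp
qed

lemma U_independent:
  assumes "u \<in> U" "v \<in> U"
  shows "{u, v} \<notin> G"
proof
  assume "{u, v} \<in> G"
  then have "card {{u, v}} \<le> card ({} :: 'a set set)"
    using assms by (intro no_augmentation) auto
  then show False by simp
qed

text \<open>Otherwise u - x - y - v is an augmenting path: two edges replace one.\<close>

lemma augment_edge:
  assumes "{x, y} \<in> M" "x \<noteq> y" "u \<in> nb x" "v \<in> nb y"
  shows "u = v"
proof (rule ccontr)
  assume "u \<noteq> v"
  have uv: "u \<in> U" "v \<in> U" "{u, x} \<in> G" "{v, y} \<in> G" using assms by (auto simp: nb_def)
  moreover have "x \<notin> U" "y \<notin> U" using assms(1) by (auto simp: U_def)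
  ultimately have "u \<noteq> x" "u \<noteq> y" "v \<noteq> x" "v \<noteq> y" by auto
  then have "disjoint {{u, x}, {v, y}}" "{u, x} \<noteq> {v, y}"
    using \<open>u \<noteq> v\<close> assms(2) by (auto simp: disjoint_def doubleton_eq_iff)
  moreover have "\<Union>{{u, x}, {v, y}} \<subseteq> \<Union>{{x, y}} \<union> U" using uv by auto
  ultimately have "card {{u, x}, {v, y}} \<le> card {{x, y}}"
    using uv assms(1) by (intro no_augmentation) auto
  then show False using \<open>{u, x} \<noteq> {v, y}\<close> by simp
qed

text \<open>Otherwise u - x - y - y' - x' - v is an augmenting path: three edges replace
  two.\<close>

lemma augment_two_edges:
  assumes "{x, y} \<in> M" "{x', y'} \<in> M" "{x, y} \<noteq> {x', y'}" "x \<noteq> y" "x' \<noteq> y'"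
    and "u \<in> nb x" "v \<in> nb x'" "u \<noteq> v"
  shows "{y, y'} \<notin> G"
proof
  assume y: "{y, y'} \<in> G"
  have uv: "u \<in> U" "v \<in> U" "{u, x} \<in> G" "{v, x'} \<in> G" using assms by (auto simp: nb_def)
  have "x \<notin> U" "y \<notin> U" "x' \<notin> U" "y' \<notin> U" using assms(1,2) by (auto simp: U_def)
  then have ne: "u \<noteq> x" "u \<noteq> y" "v \<noteq> x" "v \<noteq> y" "u \<noteq> x'" "u \<noteq> y'" "v \<noteq> x'" "v \<noteq> y'"
    using uv by auto
  have "{x, y} \<inter> {x', y'} = {}" using matching(1) assms(1-3) by (meson disjointD)
  then have ne': "x \<noteq> x'" "x \<noteq> y'" "y \<noteq> x'" "y \<noteq> y'" by auto
  let ?T = "{{u, x}, {y, y'}, {v, x'}}"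
  have "disjoint ?T"
    using ne ne' assms(4,5,8) by (auto simp: disjoint_def)
  moreover have "\<Union>?T \<subseteq> \<Union>{{x, y}, {x', y'}} \<union> U" using uv by auto
  ultimately have "card ?T \<le> card {{x, y}, {x', y'}}"
    using uv y assms(1,2) by (intro no_augmentation) auto
  moreover have "{u, x} \<noteq> {y, y'}" "{u, x} \<noteq> {v, x'}" "{y, y'} \<noteq> {v, x'}"
    using ne ne' assms(4,5,8) by (auto simp: doubleton_eq_iff)
  ultimately show False using assms(3) by simp
qed

text \<open>Common bookkeeping for all counts. Three disjoint groups of missing edges are collected:
  the three pairs inside U, edges between M and U, and edges among covered vertices. What H contains
  of them is kept in two terms, since these are bounded by different vertex covers.\<close>

lemma card_missing_ge:
  assumes H: "disjoint H" and P: "\<And>e. e \<in> M \<Longrightarrow> P e \<subseteq> cross e" and D: "D \<subseteq> [\<Union>M]\<^bsup>2\<^esup> - G"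
  shows "3 + (\<Sum>e\<in>M. card (P e)) + card D
    \<le> card ([V]\<^bsup>2\<^esup> - G - H) + card (([U]\<^bsup>2\<^esup> \<union> (\<Union>e\<in>M. P e)) \<inter> H) + card (D \<inter> H)"
proof -
  let ?UP = "\<Union>e\<in>M. P e" and ?N = "[V]\<^bsup>2\<^esup> - G"
  have finN: "finite ?N" using fin by (simp add: finite_imp_finite_nsets)
  have UV: "U \<subseteq> V" "U \<inter> \<Union>M = {}" by (auto simp: U_def)
  have cross_N: "cross e \<subseteq> ?N" if "e \<in> M" for e
  proof
    fix f assume "f \<in> cross e"
    then obtain p q where "f = {p, q}" "p \<in> e" "q \<in> U" "f \<notin> G" by (auto simp: cross_def)
    moreover from this have "p \<in> \<Union>M" using that by blast
    ultimately show "f \<in> ?N" using UV Union_M(1) by auto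
  qed
  have P_meets: "f \<inter> U \<noteq> {} \<and> f \<inter> e \<noteq> {} \<and> f \<subseteq> e \<union> U \<and> f \<noteq> {}" if "e \<in> M" "f \<in> P e" for e f
    using P[OF that(1)] that(2) by (auto simp: cross_def)
  have U_N: "[U]\<^bsup>2\<^esup> \<subseteq> ?N"
  proof
    fix f assume "f \<in> [U]\<^bsup>2\<^esup>"
    then obtain p q where "f = {p, q}" "p \<in> U" "q \<in> U" "p \<noteq> q" by (auto elim: nsets2_E)
    then show "f \<in> ?N" using UV U_independent by auto
  qed
  have UP_N: "?UP \<subseteq> ?N" using P cross_N by blast
  have D_N: "D \<subseteq> ?N" using D nsets_mono[OF Union_M(1)] by blast
  have finP: "finite (P e)" if "e \<in> M" for e using that UP_N finN by (meson UN_subset_iff finite_subset)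
  have "card ?UP = (\<Sum>e\<in>M. card (P e))"
  proof (rule card_UN_disjoint)
    show "\<forall>i\<in>M. \<forall>j\<in>M. i \<noteq> j \<longrightarrow> P i \<inter> P j = {}"
    proof (intro ballI impI)
      fix i j assume ij: "i \<in> M" "j \<in> M" "i \<noteq> j"
      then have "i \<inter> j = {}" using matching(1) by (meson disjointD)
      then have "i \<inter> (j \<union> U) = {}" using UV(2) ij by blast
      then show "P i \<inter> P j = {}" using P_meets[OF ij(1)] P_meets[OF ij(2)] by blast
    qed
  qed (use fin finP in auto)
  moreover have "card ([U]\<^bsup>2\<^esup>) = 3" using card_complete[OF fin(4)] card_U by simp
  moreover have "[U]\<^bsup>2\<^esup> \<inter> ?UP = {}"
  proof -
    have "f \<subseteq> U" if "f \<in> [U]\<^bsup>2\<^esup>" for f using that by (auto simp: nsets_def)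
    then show ?thesis using P_meets UV(2) by blast
  qed
  moreover have "([U]\<^bsup>2\<^esup> \<union> ?UP) \<inter> D = {}"
  proof -
    have 1: "f \<inter> U = {}" if "f \<in> D" for f using that D UV(2) by (auto simp: nsets_def)
    have 2: "f \<inter> U \<noteq> {}" if "f \<in> [U]\<^bsup>2\<^esup>" for f using that by (auto elim!: nsets2_E)
    have 3: "f \<inter> U \<noteq> {}" if f: "f \<in> ?UP" for f
    proof -
      obtain e where "e \<in> M" "f \<in> P e" using f by (rule UN_E)
      then show ?thesis using P_meets by simp
    qed
    show ?thesis
    proof (rule equals0I)
      fix f assume f: "f \<in> ([U]\<^bsup>2\<^esup> \<union> ?UP) \<inter> D"
      then consider "f \<in> [U]\<^bsup>2\<^esup>" | "f \<in> ?UP" by (elim IntE UnE)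
      then have "f \<inter> U \<noteq> {}" by cases (rule 2 3; assumption)+
      moreover have "f \<inter> U = {}" using f by (intro 1) (rule IntD2)
      ultimately show False by (rule notE)
    qed
  qed
  moreover have finite: "finite ([U]\<^bsup>2\<^esup>)" "finite ?UP" "finite D"
    using U_N UP_N D_N by (auto intro: finite_subset[OF _ finN])
  ultimately have "3 + (\<Sum>e\<in>M. card (P e)) + card D = card ([U]\<^bsup>2\<^esup> \<union> ?UP \<union> D)"
    by (simp add: card_Un_disjoint)
  also have "\<dots> \<le> card ((?N - H) \<union> ((([U]\<^bsup>2\<^esup> \<union> ?UP) \<inter> H) \<union> (D \<inter> H)))"
    using U_N UP_N D_N finN finite by (intro card_mono) auto
  also have "\<dots> \<le> card (?N - H) + card ((([U]\<^bsup>2\<^esup> \<union> ?UP) \<inter> H) \<union> (D \<inter> H))" by (rule card_Un_le)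
  also have "\<dots> \<le> card (?N - H) + (card (([U]\<^bsup>2\<^esup> \<union> ?UP) \<inter> H) + card (D \<inter> H))"
    using card_Un_le by (intro add_left_mono)
  finally show ?thesis by (simp only: add.assoc)
qed

text \<open>Each pair inside U has a vertex other than s, so W may omit s and still cover these
  pairs. Gaining one in this way matters when all counted edges to U avoid s.\<close>

lemma card_cross_matching_le:
  assumes H: "disjoint H" and W: "W \<subseteq> U" "U - {s} \<subseteq> W"
    and P: "\<And>e f. e \<in> M \<Longrightarrow> f \<in> P e \<Longrightarrow> f \<inter> W \<noteq> {}"
  shows "card (([U]\<^bsup>2\<^esup> \<union> (\<Union>e\<in>M. P e)) \<inter> H) \<le> card W"
proof (rule card_matching_cover_le[OF finite_subset[OF W(1) fin(4)] H])
  fix f assume "f \<in> [U]\<^bsup>2\<^esup> \<union> (\<Union>e\<in>M. P e)"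
  then show "f \<inter> W \<noteq> {}"
  proof
    assume "f \<in> [U]\<^bsup>2\<^esup>"
    then obtain p q where "f = {p, q}" "p \<in> U" "q \<in> U" "p \<noteq> q" by (rule nsets2_E)
    then show ?thesis using W(2) by blast
  next
    assume "f \<in> (\<Union>e\<in>M. P e)"
    then obtain e where "e \<in> M" "f \<in> P e" by (rule UN_E)
    then show ?thesis by (rule P)
  qed
qed

lemma oriented:
  obtains x y where "\<And>e. e \<in> M \<Longrightarrow> e = {x e, y e} \<and> x e \<noteq> y e \<and> card (nb (y e)) \<le> card (nb (x e))"
proof -
  have "\<exists>x y. e = {x, y} \<and> x \<noteq> y \<and> card (nb y) \<le> card (nb x)" if "e \<in> M" for e
  proof -
    have "e \<in> [V]\<^bsup>2\<^esup>" using that G_pairs by blast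
    then obtain a b where ab: "e = {a, b}" "a \<noteq> b" by (auto elim: nsets2_E)
    show ?thesis
    proof (cases "card (nb b) \<le> card (nb a)")
      case True
      then show ?thesis using ab by blast
    next
      case False
      then have "card (nb a) \<le> card (nb b)" by simp
      then show ?thesis using ab by (metis insert_commute)
    qed
  qed
  then show ?thesis using that by metis
qed

lemma nb_subset: "nb z \<subseteq> U" "finite (nb z)"
  using fin(4) by (auto simp: nb_def)

text \<open>X and Y may be larger than the neighbourhoods, so that fewer missing edges than
  available can be selected.\<close>

lemma cross_image:
  assumes "e = {x, y}" "x \<noteq> y" "x \<notin> U" "y \<notin> U" "X \<subseteq> U" "Y \<subseteq> U"
  defines "Q \<equiv> (\<lambda>q. {x, q}) ` (U - X) \<union> (\<lambda>q. {y, q}) ` (U - Y)"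
  shows "card Q = (3 - card X) + (3 - card Y)" and "nb x \<subseteq> X \<Longrightarrow> nb y \<subseteq> Y \<Longrightarrow> Q \<subseteq> cross e"
proof -
  have *: "card (U - Z) = 3 - card Z" if "Z \<subseteq> U" for Z
    using that fin(4) card_U by (simp add: card_Diff_subset finite_subset)
  have "card Q = card ((\<lambda>q. {x, q}) ` (U - X)) + card ((\<lambda>q. {y, q}) ` (U - Y))"
    unfolding Q_def using fin(4) assms(2-4) by (intro card_Un_disjoint) (auto simp: doubleton_eq_iff)
  also have "card ((\<lambda>q. {x, q}) ` (U - X)) = card (U - X)"
    by (rule card_image) (auto simp: inj_on_def doubleton_eq_iff)
  also have "card ((\<lambda>q. {y, q}) ` (U - Y)) = card (U - Y)"
    by (rule card_image) (auto simp: inj_on_def doubleton_eq_iff)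
  finally show "card Q = (3 - card X) + (3 - card Y)" using * assms(5,6) by simp
  show "Q \<subseteq> cross e" if "nb x \<subseteq> X" "nb y \<subseteq> Y"
  proof -
    have "{x, q} \<notin> G" if "q \<in> U - X" for q
      using that \<open>nb x \<subseteq> X\<close> by (auto simp: nb_def insert_commute)
    moreover have "{y, q} \<notin> G" if "q \<in> U - Y" for q
      using that \<open>nb y \<subseteq> Y\<close> by (auto simp: nb_def insert_commute)
    ultimately show ?thesis unfolding Q_def cross_def using assms(1) by blast
  qed
qed

end

section \<open>Missing edges counted by the class of the matching edge\<close>

locale oriented_matching = deficient_matching +
  fixes x y
  assumes orientation: "e \<in> M \<Longrightarrow> e = {x e, y e} \<and> x e \<noteq> y e \<and> card (nb (y e)) \<le> card (nb (x e))"
begin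

lemma ends:
  assumes "e \<in> M"
  shows "e = {x e, y e}" "x e \<noteq> y e" "x e \<notin> U" "y e \<notin> U" "y e \<in> \<Union>M"
proof -
  show e: "e = {x e, y e}" "x e \<noteq> y e" using orientation[OF assms] by auto
  then have "x e \<in> \<Union>M" "y e \<in> \<Union>M" using assms by blast+
  then show "x e \<notin> U" "y e \<notin> U" "y e \<in> \<Union>M" by (auto simp: U_def)
qed

lemma inj_y: "inj_on y M"
proof (rule inj_onI)
  fix e f assume ef: "e \<in> M" "f \<in> M" "y e = y f"
  then have "y e \<in> e \<inter> f" using ends(1)[OF ef(1)] ends(1)[OF ef(2)] by blast
  then show "e = f" using disjointD[OF matching(1) ef(1,2)] by blast
qed

text \<open>By the orientation x sees some vertex of U as soon as y does, and by
  \<open>augment_edge\<close> whatever the two ends see coincides.\<close>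

lemma nb_y_subset:
  assumes "e \<in> M"
  shows "nb (y e) \<subseteq> nb (x e)"
proof
  fix v assume v: "v \<in> nb (y e)"
  then have "card (nb (y e)) > 0" using nb_subset by (auto simp: card_gt_0_iff)
  then have "card (nb (x e)) > 0" using orientation[OF assms] by simp
  then obtain u where u: "u \<in> nb (x e)" by (auto simp: card_gt_0_iff)
  have "u = v"
    using augment_edge[of "x e" "y e"] ends[OF assms] assms u v by metis
  with u show "v \<in> nb (x e)" by simp
qed

lemma nb_y_empty:
  assumes "e \<in> M" "card (nb (x e)) \<ge> 2"
  shows "nb (y e) = {}"
proof (rule ccontr)
  assume "nb (y e) \<noteq> {}"
  then obtain v where v: "v \<in> nb (y e)" by blast
  have "nb (x e) \<subseteq> {v}"
    using augment_edge[of "x e" "y e" _ v] ends[OF assms(1)] assms(1) v by fastforce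
  then have "card (nb (x e)) \<le> 1" using card_mono[of "{v}"] by fastforce
  then show False using assms(2) by simp
qed

lemma y_y_missing:
  assumes "e \<in> M" "f \<in> M" "e \<noteq> f" "u \<in> nb (x e)" "v \<in> nb (x f)" "u \<noteq> v"
  shows "{y e, y f} \<in> [\<Union>M]\<^bsup>2\<^esup> - G"
proof -
  have "{y e, y f} \<notin> G"
    using augment_two_edges[of "x e" "y e" "x f" "y f" u v] ends[OF assms(1)] ends[OF assms(2)] assms
    by metis
  moreover have "y e \<noteq> y f" using inj_onD[OF inj_y] assms(1-3) by blast
  ultimately show ?thesis using ends(5) assms(1,2) by simp
qed

text \<open>An edge e of M misses at least 3, 4, 6 of the six edges between e and U when it lies in A, B, C
  respectively. That classes A and B cost so little is paid for by D: for e in A and f in A or B the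
  edge between y e and y f would complete an augmenting path of length five.\<close>

definition A where "A = {e \<in> M. card (nb (x e)) \<ge> 2}"
definition B where "B = {e \<in> M. card (nb (x e)) = 1}"
definition C where "C = {e \<in> M. card (nb (x e)) = 0}"

definition Q where "Q e = (\<lambda>q. {x e, q}) ` (U - nb (x e)) \<union> (\<lambda>q. {y e, q}) ` (U - nb (y e))"

definition D where "D = [y ` A]\<^bsup>2\<^esup> \<union> (\<lambda>(e, f). {y e, y f}) ` (A \<times> B)"

lemma finite_classes: "finite A" "finite B" "finite C"
  using fin(3) by (auto simp: A_def B_def C_def)

lemma card_classes: "card M = card A + card B + card C"
proof -
  have "M = A \<union> B \<union> C" by (auto simp: A_def B_def C_def)
  then have "card M = card (A \<union> B \<union> C)" by (rule arg_cong)
  also have "\<dots> = card (A \<union> B) + card C"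
    using finite_classes by (intro card_Un_disjoint) (auto simp: A_def B_def C_def)
  also have "card (A \<union> B) = card A + card B"
    using finite_classes by (intro card_Un_disjoint) (auto simp: A_def B_def)
  finally show ?thesis .
qed

lemma Q_cross:
  assumes "e \<in> M"
  shows "Q e \<subseteq> cross e" "card (Q e) = (3 - card (nb (x e))) + (3 - card (nb (y e)))"
  unfolding Q_def using cross_image[OF ends(1-4)[OF assms] nb_subset(1)[of "x e"] nb_subset(1)[of "y e"]]
  by simp_all

lemma card_nb_le: "card (nb z) \<le> 3"
  using nb_subset fin(4) card_U by (metis card_mono)

lemma sum_Q_ge: "3 * card A + 4 * card B + 6 * card C \<le> (\<Sum>e\<in>M. card (Q e))"
proof -
  have "(\<Sum>e\<in>M. (if e \<in> A then 3 else 0) + (if e \<in> B then 4 else 0) + (if e \<in> C then 6 else 0))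
      \<le> (\<Sum>e\<in>M. card (Q e))"
  proof (rule sum_mono)
    fix e assume e: "e \<in> M"
    have "card (nb (y e)) \<le> card (nb (x e))" using orientation[OF e] by simp
    \<comment> \<open>In A, y sees nothing and lacks three edges; in B each end sees at most one
      vertex and lacks two; in C both ends lack all three.\<close>
    then show "(if e \<in> A then 3 else 0) + (if e \<in> B then 4 else 0) + (if e \<in> C then 6 else 0) \<le> card (Q e)"
      using Q_cross(2)[OF e] nb_y_empty[OF e] card_nb_le[of "x e"] by (auto simp: A_def B_def C_def)
  qed
  moreover have "A \<subseteq> M" "B \<subseteq> M" "C \<subseteq> M" by (auto simp: A_def B_def C_def)
  then have "(\<Sum>e\<in>M. if e \<in> A then 3 else 0) = 3 * card A"
    "(\<Sum>e\<in>M. if e \<in> B then 4 else 0) = 4 * card B"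
    "(\<Sum>e\<in>M. if e \<in> C then 6 else 0) = 6 * card C"
    using fin(3) by (simp_all add: sum.If_cases Int_absorb1 flip: Int_def)
  ultimately show ?thesis by (simp add: sum.distrib)
qed

lemma A_or_B: "e \<in> A \<union> B \<Longrightarrow> e \<in> M \<and> nb (x e) \<noteq> {}"
  by (auto simp: A_def B_def)

text \<open>An edge of A sees at least two vertices of U, hence one different from any vertex its
  companion sees. Two edges of B may see the same single vertex, which is why D contains no pairs
  from B alone.\<close>

lemma D_missing: "D \<subseteq> [\<Union>M]\<^bsup>2\<^esup> - G"
proof -
  have *: "{y e, y f} \<in> [\<Union>M]\<^bsup>2\<^esup> - G" if ef: "e \<in> A" "f \<in> A \<union> B" "e \<noteq> f" for e f
  proof -
    obtain v where v: "v \<in> nb (x f)" using A_or_B[OF ef(2)] by blast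
    have "\<not> nb (x e) \<subseteq> {v}"
    proof
      assume "nb (x e) \<subseteq> {v}"
      then have "card (nb (x e)) \<le> 1" using card_mono[of "{v}"] by fastforce
      then show False using ef(1) by (simp add: A_def)
    qed
    then obtain u where "u \<in> nb (x e)" "u \<noteq> v" by blast
    then show ?thesis using y_y_missing[of e f u v] v A_or_B[OF ef(2)] ef by (auto simp: A_def)
  qed
  have "[y ` A]\<^bsup>2\<^esup> \<subseteq> [\<Union>M]\<^bsup>2\<^esup> - G"
  proof
    fix g assume "g \<in> [y ` A]\<^bsup>2\<^esup>"
    then obtain e f where "e \<in> A" "f \<in> A" "g = {y e, y f}" "y e \<noteq> y f" by (auto elim!: nsets2_E)
    moreover from this have "e \<noteq> f" by blast
    ultimately show "g \<in> [\<Union>M]\<^bsup>2\<^esup> - G" using *[of e f] by simp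
  qed
  moreover have "e \<noteq> f" if "e \<in> A" "f \<in> B" for e f using that by (auto simp: A_def B_def)
  then have "(\<lambda>(e, f). {y e, y f}) ` (A \<times> B) \<subseteq> [\<Union>M]\<^bsup>2\<^esup> - G"
    using * by (intro image_subsetI) (simp only: split_paired_all prod.case mem_Sigma_iff Un_iff simp_thms)
  ultimately show ?thesis by (simp add: D_def)
qed

lemma card_D: "card D = card A * (card A - 1) div 2 + card A * card B"
proof -
  have sub: "A \<subseteq> M" "B \<subseteq> M" "A \<inter> B = {}" by (auto simp: A_def B_def)
  have y_eq: "y e = y f \<longleftrightarrow> e = f" if "e \<in> M" "f \<in> M" for e f using inj_onD[OF inj_y] that by blast
  have "card (y ` A) = card A" using inj_on_subset[OF inj_y sub(1)] by (rule card_image)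
  then have "card ([y ` A]\<^bsup>2\<^esup>) = card A * (card A - 1) div 2"
    using card_complete[of "y ` A"] finite_classes by simp
  moreover have "inj_on (\<lambda>(e, f). {y e, y f}) (A \<times> B)"
  proof (rule inj_onI)
    fix p q assume pq: "p \<in> A \<times> B" "q \<in> A \<times> B" "(\<lambda>(e, f). {y e, y f}) p = (\<lambda>(e, f). {y e, y f}) q"
    obtain e f e' f' where ef: "p = (e, f)" "q = (e', f')" by fastforce
    have "{y e, y f} = {y e', y f'}" using pq(3) ef by simp
    moreover have "e \<in> A" "f \<in> B" "e' \<in> A" "f' \<in> B" using pq ef by auto
    ultimately have "y e = y e' \<and> y f = y f' \<or> y e = y f' \<and> y f = y e'"
      "e \<in> M" "f \<in> M" "e' \<in> M" "f' \<in> M" "e \<noteq> f'"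
      using sub by (auto simp: doubleton_eq_iff)
    then show "p = q" using ef y_eq by metis
  qed
  then have "card ((\<lambda>(e, f). {y e, y f}) ` (A \<times> B)) = card A * card B"
    by (simp add: card_image card_cartesian_product)
  moreover have "[y ` A]\<^bsup>2\<^esup> \<inter> (\<lambda>(e, f). {y e, y f}) ` (A \<times> B) = {}"
  proof (rule equals0I)
    fix g assume g: "g \<in> [y ` A]\<^bsup>2\<^esup> \<inter> (\<lambda>(e, f). {y e, y f}) ` (A \<times> B)"
    then obtain e f where "e \<in> A" "f \<in> B" "g = {y e, y f}" by auto
    moreover have "g \<subseteq> y ` A" using g by (auto simp: nsets_def)
    ultimately obtain e' where "e' \<in> A" "f \<in> B" "y f = y e'" by auto
    then show False using y_eq[of f e'] sub by blast
  qed
  moreover have "finite ([y ` A]\<^bsup>2\<^esup>)" "finite ((\<lambda>(e, f). {y e, y f}) ` (A \<times> B))"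
    using finite_classes by (simp_all add: finite_imp_finite_nsets)
  ultimately show ?thesis unfolding D_def by (simp add: card_Un_disjoint)
qed

text \<open>For the first bound, the vertices \<open>y e\<close> with e in A meet every edge of D;
  for the second, D lives on the vertices belonging to A and B. The second is the stronger one when
  A is larger than B.\<close>

lemma card_D_matching_le:
  assumes H: "disjoint H"
  shows "card (D \<inter> H) \<le> card A" "2 * card (D \<inter> H) \<le> card A + card B"
proof -
  have "g \<inter> y ` A \<noteq> {}" if "g \<in> D" for g
    using that unfolding D_def by (auto elim!: nsets2_E)
  then have "card (D \<inter> H) \<le> card (y ` A)"
    using finite_classes H by (intro card_matching_cover_le) auto
  also have "\<dots> \<le> card A" using finite_classes by (intro card_image_le)
  finally show "card (D \<inter> H) \<le> card A" .
  have "D \<subseteq> [y ` (A \<union> B)]\<^bsup>2\<^esup>"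
  proof
    fix g assume g: "g \<in> D"
    then have "g \<subseteq> y ` (A \<union> B)" unfolding D_def by (auto elim!: nsets2_E)
    moreover have "card g = 2" "finite g" using g D_missing by (auto simp: nsets_def)
    ultimately show "g \<in> [y ` (A \<union> B)]\<^bsup>2\<^esup>" by (simp add: nsets_def)
  qed
  moreover have "disjoint (D \<inter> H)" using H by (auto simp: disjoint_def)
  ultimately have "2 * card (D \<inter> H) \<le> card (y ` (A \<union> B))"
    using finite_classes by (intro matching_card_le) auto
  also have "\<dots> \<le> card (A \<union> B)" using finite_classes by (intro card_image_le) auto
  also have "\<dots> \<le> card A + card B" by (rule card_Un_le)
  finally show "2 * card (D \<inter> H) \<le> card A + card B" .
qed

lemma twice_card_D: "2 * card D = card A * (card A - 1) + 2 * (card A * card B)"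
proof -
  have "even (card A * (card A - 1))" by (cases "card A") auto
  then show ?thesis using card_D by simp
qed

text \<open>Measured against four missing edges per matching edge, A falls short by one each and C
  has two to spare, so the claim reduces to |A| \<le> |D| + 2|C|. This fails if M consists of one or
  two edges of A, where |D| is 0 or 1.\<close>

lemma missing_ge:
  assumes "card M \<ge> 3"
  shows "4 * card M + 3 \<le> card ([V]\<^bsup>2\<^esup> - G)"
proof -
  have le: "3 + (3 * card A + 4 * card B + 6 * card C) + card D \<le> card ([V]\<^bsup>2\<^esup> - G)"
    using card_missing_ge[of "{}" Q D] Q_cross(1) D_missing sum_Q_ge by (simp add: disjoint_def)
  consider "card A = 0" | "card A = 1" | "card A = 2" | "card A \<ge> 3" by linarith
  then have "card A \<le> card D + 2 * card C"
  proof cases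
    case 4
    then have "card A * 2 \<le> card A * (card A - 1)" by (intro mult_le_mono2) simp
    then show ?thesis using twice_card_D by linarith
  qed (use assms card_classes twice_card_D in auto)
  then show ?thesis using le card_classes by linarith
qed

text \<open>H may cancel the three pairs inside U and part of D, which leaves |A| + |D \<inter> H| +
  1 \<le> |D| + 2|C| to be shown. With A and C empty both |D| and |C| vanish, so that case is
  treated apart; if M were four edges of A, then |D| = 6 and the bound |D \<inter> H| \<le> 2 would
  leave the estimate one short.\<close>

lemma missing_Diff_matching_ge_aux:
  assumes "card M \<ge> 5" and H: "disjoint H" and ne: "A \<union> C \<noteq> {}"
  shows "4 * card M + 1 \<le> card ([V]\<^bsup>2\<^esup> - G - H)"
proof -
  have "card (([U]\<^bsup>2\<^esup> \<union> (\<Union>e\<in>M. Q e)) \<inter> H) \<le> card U"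
    using H by (rule card_cross_matching_le) (auto simp: Q_def)
  then have le: "3 * card A + 4 * card B + 6 * card C + card D \<le> card ([V]\<^bsup>2\<^esup> - G - H) + card (D \<inter> H)"
    using card_missing_ge[OF H Q_cross(1) D_missing] sum_Q_ge card_U by simp
  have DH: "card (D \<inter> H) \<le> card A" "2 * card (D \<inter> H) \<le> card A + card B"
    using card_D_matching_le[OF H] by auto
  have AC: "card A + card C \<ge> 1"
  proof (rule ccontr)
    assume "\<not> card A + card C \<ge> 1"
    then have "card A = 0" "card C = 0" by linarith+
    then have "A = {}" "C = {}" using finite_classes by simp_all
    then show False using ne by simp
  qed
  \<comment> \<open>From |A| = 6 on, |D| is at least 5|A|/2, which is ample; fixing each smaller
    value makes the products in |D| linear.\<close>
  consider "card A = 0" | "card A = 1" | "card A = 2" | "card A = 3" | "card A = 4" | "card A = 5" | "card A \<ge> 6"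
    by linarith
  then have "card A + card (D \<inter> H) + 1 \<le> card D + 2 * card C"
  proof cases
    case 7
    then have "card A * 5 \<le> card A * (card A - 1)" by (intro mult_le_mono2) simp
    then show ?thesis using twice_card_D DH 7 by linarith
  qed (use assms(1) card_classes twice_card_D DH AC in auto)
  then show ?thesis using le card_classes by linarith
qed

text \<open>Each edge e of M now has a single neighbour t e in U. If all t e agree, the two other
  vertices of U meet all counted edges, so H contains at most two of these; otherwise two further
  missing edges share an endpoint, and H contains at most one of them.\<close>

lemma missing_Diff_matching_ge_B:
  assumes "card M \<ge> 3" and H: "disjoint H" and B: "A \<union> C = {}"
  shows "4 * card M + 1 \<le> card ([V]\<^bsup>2\<^esup> - G - H)"
proof -
  have "card (nb (x e)) = 1" if "e \<in> M" for e
  proof -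
    have "e \<notin> A" "e \<notin> C" using B by blast+
    then show ?thesis using that by (simp add: A_def C_def)
  qed
  then have "\<forall>e\<in>M. \<exists>t. nb (x e) = {t}" by (meson card_1_singletonE)
  then obtain t where t: "\<And>e. e \<in> M \<Longrightarrow> nb (x e) = {t e}" by metis
  have tU: "t e \<in> U" if "e \<in> M" for e using t[OF that] nb_subset by blast
  \<comment> \<open>Unlike \<open>Q e\<close>, \<open>R e\<close> never contains the edge from
    \<open>y e\<close> to \<open>t e\<close>, even when it is missing. It has exactly four elements,
    and none of them contains \<open>t e\<close>.\<close>
  define R where "R e = (\<lambda>q. {x e, q}) ` (U - {t e}) \<union> (\<lambda>q. {y e, q}) ` (U - {t e})" for e
  have R: "R e \<subseteq> cross e" "card (R e) = 4" if "e \<in> M" for e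
    unfolding R_def using cross_image[OF ends(1-4)[OF that], of "{t e}" "{t e}"] tU[OF that] t[OF that] nb_y_subset[OF that]
    by simp_all
  have sumR: "(\<Sum>e\<in>M. card (R e)) = 4 * card M" using R by simp
  show ?thesis
  proof (cases "\<exists>s. \<forall>e\<in>M. t e = s")
    case True
    then obtain s where s: "\<And>e. e \<in> M \<Longrightarrow> t e = s" by blast
    have "M \<noteq> {}" using assms(1) by auto
    then have "s \<in> U" using s tU by blast
    have "card (([U]\<^bsup>2\<^esup> \<union> (\<Union>e\<in>M. R e)) \<inter> H) \<le> card (U - {s})"
      using H by (rule card_cross_matching_le[of _ _ s]) (auto simp: R_def s)
    also have "\<dots> = 2" using card_U \<open>s \<in> U\<close> by simp
    finally show ?thesis using card_missing_ge[OF H R(1), of "{}"] sumR by simp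
  next
    case False
    \<comment> \<open>Take two edges with different values of \<open>t\<close> and any third one:
      whichever of the first two disagrees with the third also disagrees with both others. Its y-end
      is then shared by two missing edges.\<close>
    have "\<exists>e f g. {e, f, g} \<subseteq> M \<and> f \<noteq> g \<and> t e \<noteq> t f \<and> t e \<noteq> t g"
    proof -
      have "M \<noteq> {}" using assms(1) by auto
      then obtain e where e: "e \<in> M" by blast
      then obtain f where f: "f \<in> M" "t f \<noteq> t e" using False by metis
      have "\<not> M \<subseteq> {e, f}"
      proof
        assume "M \<subseteq> {e, f}"
        then have "card M \<le> card {e, f}" by (intro card_mono) auto
        also have "\<dots> \<le> 2" by (simp add: card_insert_if)
        finally show False using assms(1) by simp
      qed
      then obtain g where g: "g \<in> M" "g \<noteq> e" "g \<noteq> f" by blast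
      show ?thesis
      proof (cases "t g = t e")
        case True
        then have "{f, e, g} \<subseteq> M \<and> e \<noteq> g \<and> t f \<noteq> t e \<and> t f \<noteq> t g" using e f g by auto
        then show ?thesis by blast
      next
        case False
        then have "{e, f, g} \<subseteq> M \<and> f \<noteq> g \<and> t e \<noteq> t f \<and> t e \<noteq> t g" using e f g by auto
        then show ?thesis by blast
      qed
    qed
    then obtain e f g where efg: "{e, f, g} \<subseteq> M" "f \<noteq> g" "t e \<noteq> t f" "t e \<noteq> t g"
      by (elim exE conjE)
    then have ef: "e \<in> M" "f \<in> M" "g \<in> M" "e \<noteq> f" "e \<noteq> g" by auto
    let ?D = "{{y e, y f}, {y e, y g}}"
    have D: "?D \<subseteq> [\<Union>M]\<^bsup>2\<^esup> - G"
      using y_y_missing[OF ef(1,2,4), of "t e" "t f"] y_y_missing[OF ef(1,3,5), of "t e" "t g"] efg t ef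
      by (simp only: insert_subset empty_subsetI simp_thms singleton_iff)
    have "y e \<noteq> y f" "y e \<noteq> y g" "y f \<noteq> y g" using inj_onD[OF inj_y] efg(2) ef by blast+
    then have card_D': "card ?D = 2" by (simp add: doubleton_eq_iff)
    have "card (?D \<inter> H) \<le> card {y e}"
      using H by (intro card_matching_cover_le) auto
    moreover have "card (([U]\<^bsup>2\<^esup> \<union> (\<Union>e\<in>M. R e)) \<inter> H) \<le> card U"
      using H by (rule card_cross_matching_le) (auto simp: R_def)
    ultimately show ?thesis using card_missing_ge[OF H R(1) D] sumR card_D' card_U by simp
  qed
qed

end

lemma (in deficient_matching) missing_ge:
  assumes "card M \<ge> 3"
  shows "4 * card M + 3 \<le> card ([V]\<^bsup>2\<^esup> - G)"
proof (rule oriented)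
  fix x y assume "\<And>e. e \<in> M \<Longrightarrow> e = {x e, y e} \<and> x e \<noteq> y e \<and> card (nb (y e)) \<le> card (nb (x e))"
  then interpret oriented_matching V G M x y by unfold_locales
  show ?thesis by (rule missing_ge[OF assms])
qed

lemma (in deficient_matching) missing_Diff_matching_ge:
  assumes "card M \<ge> 5" "disjoint H"
  shows "4 * card M + 1 \<le> card ([V]\<^bsup>2\<^esup> - G - H)"
proof (rule oriented)
  fix x y assume "\<And>e. e \<in> M \<Longrightarrow> e = {x e, y e} \<and> x e \<noteq> y e \<and> card (nb (y e)) \<le> card (nb (x e))"
  then interpret oriented_matching V G M x y by unfold_locales
  show ?thesis
    using missing_Diff_matching_ge_aux[OF assms] missing_Diff_matching_ge_B[OF _ assms(2)] assms(1)
    by (cases "A \<union> C = {}") auto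
qed

text \<open>Adding edges while the graph remains precluded leads to one that a single further edge turns
  into a graph with a near-perfect matching; removing that edge leaves a matching missing three
  vertices.\<close>

lemma deficient_supergraph:
  assumes "simple_graph V G" "precluded V G" "card V = 2 * m + 3"
  obtains G' M where "G \<subseteq> G'" "card M = m" "deficient_matching V G' M"
proof -
  have fin: "finite V" "finite ([V]\<^bsup>2\<^esup>)"
    using assms(1) by (auto simp: simple_graph_def finite_imp_finite_nsets)
  have "\<exists>G' M. G \<subseteq> G' \<and> card M = m \<and> deficient_matching V G' M"
    using assms(1,2)
  proof (induction "card ([V]\<^bsup>2\<^esup> - G)" arbitrary: G rule: less_induct)
    case less
    have full: "simple_graph V ([V]\<^bsup>2\<^esup>)" using fin by (simp add: simple_graph_def)
    obtain N where "disjoint N" "card N = m + 1" "N \<subseteq> [V]\<^bsup>2\<^esup>"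
      using near_perfect_matching_exists[OF fin(1), of "m + 1"] assms(3) by auto
    then have "\<not> precluded V ([V]\<^bsup>2\<^esup>)"
      using assms(3) by (intro not_precludedI[OF full]) auto
    then have "G \<noteq> [V]\<^bsup>2\<^esup>" using less.prems by auto
    then obtain e where e: "e \<in> [V]\<^bsup>2\<^esup>" "e \<notin> G" using less.prems(1) by (auto simp: simple_graph_def)
    have sg: "simple_graph V (insert e G)" using less.prems(1) e by (simp add: simple_graph_def)
    show ?case
    proof (cases "precluded V (insert e G)")
      case True
      have "card ([V]\<^bsup>2\<^esup> - insert e G) < card ([V]\<^bsup>2\<^esup> - G)"
        using e fin by (intro psubset_card_mono) auto
      then show ?thesis using less.hyps[OF _ sg True] by blast
    next
      case False
      then obtain N where N: "N \<subseteq> insert e G" "disjoint N" "card V \<le> 2 * card N + 1"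
        using not_precluded_iff[OF sg] by blast
      have sub: "N - {e} \<subseteq> G" "disjoint (N - {e})" using N by (auto simp: disjoint_def)
      have finN: "finite N" using N(1) simple_graph_finite[OF sg] finite_subset by blast
      have "m + 1 \<le> card N" using N(3) assms(3) by linarith
      then have "card (N - {e}) \<ge> m" using diff_card_le_card_Diff[of "{e}" N] by simp
      then obtain M where M: "M \<subseteq> N - {e}" "card M = m" by (meson obtain_subset_with_card_n)
      then have "M \<subseteq> G" "disjoint M" using sub(1) pairwise_subset[OF sub(2)] by blast+
      then have "deficient_matching V G M"
        using less.prems M(2) assms(3) by (simp add: deficient_matching_def)
      then show ?thesis using M(2) by blast
    qed
  qed
  then show ?thesis using that by blast
qed

lemma complete_missing_ge:
  assumes "simple_graph V G" "precluded V G" "card V = 2 * m + 3" "m \<ge> 3"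
  shows "4 * m + 3 \<le> card ([V]\<^bsup>2\<^esup> - G)"
proof -
  obtain G' M where G': "G \<subseteq> G'" "card M = m" "deficient_matching V G' M"
    using deficient_supergraph[OF assms(1-3)] .
  have "4 * m + 3 \<le> card ([V]\<^bsup>2\<^esup> - G')"
    using deficient_matching.missing_ge[OF G'(3)] G'(2) assms(4) by simp
  also have "\<dots> \<le> card ([V]\<^bsup>2\<^esup> - G)"
    using G'(1) assms(1) by (intro card_mono) (auto simp: simple_graph_def finite_imp_finite_nsets)
  finally show ?thesis .
qed

lemma complete_missing_Diff_matching_ge:
  assumes "simple_graph V G" "precluded V G" "card V = 2 * m + 3" "m \<ge> 5" "disjoint H"
  shows "4 * m + 1 \<le> card ([V]\<^bsup>2\<^esup> - G - H)"
proof -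
  obtain G' M where G': "G \<subseteq> G'" "card M = m" "deficient_matching V G' M"
    using deficient_supergraph[OF assms(1-3)] .
  have "4 * m + 1 \<le> card ([V]\<^bsup>2\<^esup> - G' - H)"
    using deficient_matching.missing_Diff_matching_ge[OF G'(3) _ assms(5)] G'(2) assms(4) by simp
  also have "\<dots> \<le> card ([V]\<^bsup>2\<^esup> - G - H)"
    using G'(1) assms(1) by (intro card_mono) (auto simp: simple_graph_def finite_imp_finite_nsets)
  finally show ?thesis .
qed

section \<open>Graphs of odd order\<close>

lemma sum_adjacent:
  assumes "simple_graph V E" "u \<in> V"
  shows "(\<Sum>v\<in>V - {u}. if {u, v} \<in> E then 1 else 0) = degree E u"
proof -
  have fin: "finite V" and sub: "E \<subseteq> [V]\<^bsup>2\<^esup>" using assms by (auto simp: simple_graph_def)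
  have "{e \<in> E. u \<in> e} = (\<lambda>v. {u, v}) ` {v \<in> V - {u}. {u, v} \<in> E}"
  proof
    show "{e \<in> E. u \<in> e} \<subseteq> (\<lambda>v. {u, v}) ` {v \<in> V - {u}. {u, v} \<in> E}"
    proof
      fix e assume e: "e \<in> {e \<in> E. u \<in> e}"
      then obtain a b where ab: "e = {a, b}" "a \<in> V" "b \<in> V" "a \<noteq> b" using sub by (auto elim!: nsets2_E)
      then consider "u = a" | "u = b" using e by blast
      then show "e \<in> (\<lambda>v. {u, v}) ` {v \<in> V - {u}. {u, v} \<in> E}"
      proof cases
        case 1
        then show ?thesis using ab e by auto
      next
        case 2
        then have "e = {u, a}" using ab by auto
        then show ?thesis using 2 ab e by auto
      qed
    qed
  qed auto
  moreover have "inj_on (\<lambda>v. {u, v}) {v \<in> V - {u}. {u, v} \<in> E}"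
    by (auto simp: inj_on_def doubleton_eq_iff)
  ultimately have "degree E u = card {v \<in> V - {u}. {u, v} \<in> E}"
    by (simp add: degree_def card_image)
  also have "\<dots> = (\<Sum>v\<in>V - {u}. if {u, v} \<in> E then 1 else 0)"
    using fin by (simp add: sum.If_cases Int_def)
  finally show ?thesis by simp
qed

text \<open>Sums \<open>mp_le_degree_pair\<close> over all v other than u. Of the two copies of
  \<open>degree E u\<close> on the left, one collects the adjacency corrections and the other
  completes the remaining degrees to 2|E|.\<close>

lemma mp_degree_sum_le:
  assumes "simple_graph V E" "u \<in> V"
  shows "(card V - 1) * mp V E + 2 * degree E u \<le> (card V - 1) * degree E u + 2 * card E"
proof -
  have fin: "finite V" using assms by (simp add: simple_graph_def)
  have "(\<Sum>v\<in>V - {u}. mp V E + (if {u, v} \<in> E then 1 else 0)) \<le> (\<Sum>v\<in>V - {u}. degree E u + degree E v)"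
    using assms by (intro sum_mono mp_le_degree_pair) auto
  then have "(card V - 1) * mp V E + degree E u \<le> (card V - 1) * degree E u + (\<Sum>v\<in>V - {u}. degree E v)"
    using sum_adjacent[OF assms] fin assms(2) by (simp add: sum.distrib)
  moreover have "degree E u + (\<Sum>v\<in>V - {u}. degree E v) = 2 * card E"
    using sum_degree[OF assms(1)] sum.remove[OF fin assms(2), of "degree E"] by simp
  ultimately show ?thesis by linarith
qed

text \<open>A second summation, over u, turns every degree into 2|E|. Moving the 4|E| across would
  give the factor 4n - 6.\<close>

lemma mp_card_edges_le:
  assumes "simple_graph V E"
  shows "card V * (card V - 1) * mp V E + 4 * card E \<le> (4 * card V - 2) * card E"
proof -
  let ?n = "card V"
  have "(\<Sum>u\<in>V. (?n - 1) * mp V E + 2 * degree E u) \<le> (\<Sum>u\<in>V. (?n - 1) * degree E u + 2 * card E)"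
    using mp_degree_sum_le[OF assms] by (intro sum_mono)
  then have le: "?n * ((?n - 1) * mp V E) + 2 * (2 * card E) \<le> (?n - 1) * (2 * card E) + ?n * (2 * card E)"
    using sum_degree[OF assms] by (simp add: sum.distrib flip: sum_distrib_left)
  \<comment> \<open>Without vertices the factor \<open>4 * card V - 2\<close> truncates to
    0.\<close>
  show ?thesis
  proof (cases "?n = 0")
    case True
    then have "E = {}" using assms by (auto simp: simple_graph_def nsets_def)
    then show ?thesis using True by simp
  next
    case False
    then obtain p where "?n = Suc p" by (metis not0_implies_Suc)
    then show ?thesis using le by (simp add: algebra_simps)
  qed
qed

section \<open>Sizes forced by mp at least 1, 2 and 3\<close>

lemma card_le_of_mp_ge_1:
  assumes "simple_graph V E" "1 \<le> mp V E"
  shows "card V \<le> 2 * card E + 1"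
proof -
  have "\<not> precluded V E" using mp_le[of "{}" E V] assms(2) by auto
  then obtain M where M: "M \<subseteq> E" "card V \<le> 2 * card M + 1" using not_precluded_iff[OF assms(1)] by blast
  have "card M \<le> card E" using M(1) simple_graph_finite[OF assms(1)] by (intro card_mono)
  with M(2) show ?thesis by simp
qed

text \<open>A pendant vertex v and its neighbour w, which must have another neighbour, can be removed
  together: at least two edges disappear and the deletion of one edge still does not preclude.\<close>

lemma card_le_of_robust:
  assumes "simple_graph V E" "odd (card V)"
    and "\<And>F. F \<subseteq> E \<Longrightarrow> card F \<le> 1 \<Longrightarrow> \<not> precluded V (E - F)"
  shows "card V \<le> card E + 1"
  using assms
proof (induction "card V" arbitrary: V E rule: less_induct)
  case less
  have fin: "finite V" "finite E" and sub: "E \<subseteq> [V]\<^bsup>2\<^esup>"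
    using less.prems(1) simple_graph_finite by (auto simp: simple_graph_def)
  have deg0: "v \<notin> e" if "degree E v = 0" "e \<in> E" for v e
    using that fin by (auto simp: degree_def)
  show ?case
  proof (cases "\<exists>v\<in>V. degree E v = 1")
    case True
    then obtain v where v: "v \<in> V" "degree E v = 1" by blast
    then obtain e where e: "{e \<in> E. v \<in> e} = {e}" by (auto simp: degree_def card_1_singleton_iff)
    then have eE: "e \<in> E" "v \<in> e" by blast+
    then have "e \<in> [V]\<^bsup>2\<^esup>" using sub by blast
    then obtain w where w: "e = {v, w}" "w \<in> V" "v \<noteq> w" using eE(2) by (auto elim!: nsets2_E)
    have v_edge: "f = {v, w}" if "f \<in> E" "v \<in> f" for f using e w(1) that by blast
    define V' E' where "V' = V - {v, w}" and "E' = {f \<in> E. w \<notin> f \<and> v \<notin> f}"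
    have V': "card V = card V' + 2"
    proof -
      have "{v, w} \<subseteq> V" using v w by simp
      then have "card V' = card V - card {v, w}" unfolding V'_def by (intro card_Diff_subset) auto
      moreover have "card {v, w} \<le> card V" using v w fin by (intro card_mono) auto
      ultimately show ?thesis using w(3) by simp
    qed
    have sg': "simple_graph V' E'"
      using fin sub by (auto simp: simple_graph_def V'_def E'_def nsets_def)
    have "card V' \<le> card E' + 1"
    proof (rule less.hyps[OF _ sg'])
      show "card V' < card V" "odd (card V')" using V' less.prems(2) by auto
      fix F assume F: "F \<subseteq> E'" "card F \<le> 1"
      then have "\<not> precluded V (E - F)" by (intro less.prems(3)) (auto simp: E'_def)
      then obtain M where M: "M \<subseteq> E - F" "disjoint M" "card V \<le> 2 * card M + 1"
        using not_precluded_iff[OF simple_graph_subset[OF less.prems(1)]] by (metis Diff_subset)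
      define M' where "M' = {f \<in> M. w \<notin> f}"
      have finM: "finite M" using M(1) fin(2) by (meson Diff_subset finite_subset)
      \<comment> \<open>At most one edge of M contains w, and any edge at v does; dropping it gives
        a matching that avoids v and w and leaves no more vertices uncovered in V' than M did in
        V.\<close>
      have "card (M \<inter> {f. w \<in> f}) \<le> 1"
        using card_matching_cover_le[of "{w}" M "{f. w \<in> f}"] M(2) by (simp add: Int_commute)
      moreover have "M = M' \<union> (M \<inter> {f. w \<in> f})" by (auto simp: M'_def)
      then have "card M \<le> card M' + card (M \<inter> {f. w \<in> f})" by (metis card_Un_le)
      ultimately have "card M \<le> card M' + 1" by simp
      moreover have "M' \<subseteq> E' - F" using M(1) v_edge by (auto simp: M'_def E'_def)
      moreover have "disjoint M'" by (rule pairwise_subset[OF M(2)]) (simp add: M'_def)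
      ultimately show "\<not> precluded V' (E' - F)"
        using M(3) V' by (intro not_precludedI[OF simple_graph_subset[OF sg']]) auto
    qed
    \<comment> \<open>If {v, w} were the only edge at w, deleting it would isolate both v and
      w.\<close>
    moreover have "card {f \<in> E. w \<in> f} \<ge> 2"
    proof (rule ccontr)
      assume "\<not> card {f \<in> E. w \<in> f} \<ge> 2"
      then have "card {f \<in> E. w \<in> f} \<le> Suc 0" by simp
      then have w_edge: "f = e" if "f \<in> E" "w \<in> f" for f
        using that eE(1) w(1) fin(2) by (auto simp: card_le_Suc0_iff_eq)
      have "precluded V (E - {e})"
        using v w v_edge w_edge
        by (intro precluded_isolated[OF simple_graph_subset[OF less.prems(1)], of _ "{v, w}"]) auto
      then show False using less.prems(3)[of "{e}"] eE by simp
    qed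
    moreover have "card E' + card {f \<in> E. w \<in> f} \<le> card E"
    proof -
      have "card E' + card {f \<in> E. w \<in> f} = card (E' \<union> {f \<in> E. w \<in> f})"
        using fin by (intro card_Un_disjoint[symmetric]) (auto simp: E'_def)
      also have "\<dots> \<le> card E" using fin by (intro card_mono) (auto simp: E'_def)
      finally show ?thesis .
    qed
    ultimately show ?thesis using V' by linarith
  next
    case False
    \<comment> \<open>At most one vertex is isolated, since two would preclude. With degree one
      excluded, all other degrees are at least two, which gives 2(n - 1) \<le> 2|E|.\<close>
    obtain u where u: "u \<in> V" "\<And>v. v \<in> V - {u} \<Longrightarrow> degree E v \<noteq> 0"
    proof -
      have "V \<noteq> {}" using less.prems(2) by auto
      have "v = u" if uv: "u \<in> V" "v \<in> V" "degree E u = 0" "degree E v = 0" for u v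
      proof (rule ccontr)
        assume "v \<noteq> u"
        then have "precluded V E"
          using uv deg0 by (intro precluded_isolated[OF less.prems(1), of "{u, v}"]) auto
        then show False using less.prems(3)[of "{}"] by simp
      qed
      then show ?thesis using that \<open>V \<noteq> {}\<close> by (metis DiffD1 DiffD2 all_not_in_conv singletonI)
    qed
    have "degree E v \<ge> 2" if "v \<in> V - {u}" for v
      using u(2)[OF that] False that by (metis DiffD1 One_nat_def less_2_cases not_less)
    then have "(\<Sum>v\<in>V - {u}. 2) \<le> (\<Sum>v\<in>V - {u}. degree E v)" by (intro sum_mono)
    also have "\<dots> \<le> (\<Sum>v\<in>V. degree E v)" using fin by (intro sum_mono2) auto
    also have "\<dots> = 2 * card E" using sum_degree[OF less.prems(1)] .
    finally show ?thesis using fin u(1) by simp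
  qed
qed

lemma card_le_of_mp_ge_2:
  assumes "simple_graph V E" "odd (card V)" "2 \<le> mp V E"
  shows "card V \<le> card E + 1"
  using assms(1,2)
proof (rule card_le_of_robust)
  fix F assume "F \<subseteq> E" "card F \<le> 1"
  then show "\<not> precluded V (E - F)" using mp_le[of F E V] assms(3) by auto
qed

text \<open>If all degrees are at least two, the degree sum gives n edges. A vertex of low degree
  forces high degrees elsewhere: \<open>mp_degree_sum_le\<close> gives 2|E| \<ge> 3(n - 1) for
  degree 0 and 2|E| \<ge> 2n for degree 1.\<close>

lemma card_le_of_mp_ge_3:
  assumes "simple_graph V E" "3 \<le> mp V E" "card V \<ge> 3"
  shows "card V \<le> card E"
proof (cases "\<exists>u\<in>V. degree E u \<le> 1")
  case True
  then obtain u where u: "u \<in> V" "degree E u \<le> 1" by blast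
  have "(card V - 1) * 3 \<le> (card V - 1) * mp V E" using assms(2) by simp
  then have "(card V - 1) * 3 + 2 * degree E u \<le> (card V - 1) * degree E u + 2 * card E"
    using mp_degree_sum_le[OF assms(1) u(1)] by linarith
  moreover have "degree E u = 0 \<or> degree E u = 1" using u(2) by linarith
  ultimately show ?thesis using assms(3) by (elim disjE) (simp_all add: diff_mult_distrib)
next
  case False
  then have "2 \<le> degree E v" if "v \<in> V" for v using that by (auto simp: not_le numeral_2_eq_2 Suc_le_eq)
  then have "(\<Sum>v\<in>V. 2) \<le> (\<Sum>v\<in>V. degree E v)" by (intro sum_mono)
  then show ?thesis using sum_degree[OF assms(1)] by simp
qed

section \<open>Complements of graphs with mp close to 2n - 3\<close>

lemma missing_degree_pair:
  assumes "simple_graph V E" "2 * card V \<le> mp V E + j + 3" "u \<in> V" "v \<in> V" "u \<noteq> v"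
  defines "H \<equiv> [V]\<^bsup>2\<^esup> - E"
  shows "degree H u + degree H v \<le> j + (if {u, v} \<in> H then 1 else 0)"
proof -
  have fin: "finite V" "finite E" and sub: "E \<subseteq> [V]\<^bsup>2\<^esup>"
    using assms(1) simple_graph_finite by (auto simp: simple_graph_def)
  have K: "simple_graph V ([V]\<^bsup>2\<^esup>)" using fin by (simp add: simple_graph_def)
  \<comment> \<open>Degrees in E and in its complement H add up to n - 1, so lower bounds for degree
    sums in E become upper bounds in H; j allows mp to fall j below 2n - 3.\<close>
  have deg: "degree E w + degree H w = card V - 1" if "w \<in> V" for w
  proof -
    have "degree ([V]\<^bsup>2\<^esup>) w = (\<Sum>v\<in>V - {w}. if {w, v} \<in> [V]\<^bsup>2\<^esup> then 1 else 0)"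
      by (rule sum_adjacent[OF K that, symmetric])
    also have "\<dots> = (\<Sum>v\<in>V - {w}. 1)" using that by (intro sum.cong) auto
    also have "\<dots> = card V - 1" using fin that by simp
    finally have "degree ([V]\<^bsup>2\<^esup>) w = card V - 1" .
    moreover have "{e \<in> [V]\<^bsup>2\<^esup>. w \<in> e} = {e \<in> E. w \<in> e} \<union> {e \<in> H. w \<in> e}"
      using sub by (auto simp: H_def)
    moreover have "finite {e \<in> E. w \<in> e}" "finite {e \<in> H. w \<in> e}" "{e \<in> E. w \<in> e} \<inter> {e \<in> H. w \<in> e} = {}"
      using fin by (auto simp: H_def finite_imp_finite_nsets)
    ultimately show ?thesis by (simp add: degree_def card_Un_disjoint)
  qed
  have "card {u, v} \<le> card V" using assms(3,4) fin by (intro card_mono) auto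
  then have "card V \<ge> 2" using assms(5) by simp
  moreover have "mp V E + (if {u, v} \<in> E then 1 else 0) \<le> degree E u + degree E v"
    using mp_le_degree_pair[OF assms(1,3-5)] .
  moreover have "{u, v} \<in> E \<longleftrightarrow> {u, v} \<notin> H" using assms(3-5) sub by (auto simp: H_def)
  ultimately show ?thesis using deg[OF assms(3)] deg[OF assms(4)] assms(2) by (auto split: if_splits)
qed

lemma degree_pos:
  assumes "finite E" "e \<in> E" "v \<in> e"
  shows "degree E v \<ge> 1"
proof -
  have "card {e} \<le> card {e \<in> E. v \<in> e}" using assms by (intro card_mono) auto
  then show ?thesis by (simp add: degree_def)
qed

lemma missing_edge_degrees:
  assumes "simple_graph V E" "2 * card V \<le> mp V E + j + 3"
  obtains H where "H = [V]\<^bsup>2\<^esup> - E" "simple_graph V H" "finite H"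
    "\<And>u v. u \<in> V \<Longrightarrow> v \<in> V \<Longrightarrow> u \<noteq> v \<Longrightarrow> degree H u + degree H v \<le> j + (if {u, v} \<in> H then 1 else 0)"
    "\<And>e u. e \<in> H \<Longrightarrow> u \<in> e \<Longrightarrow> \<exists>v. e = {u, v} \<and> u \<in> V \<and> v \<in> V \<and> u \<noteq> v \<and> degree H u \<ge> 1 \<and> degree H v \<ge> 1"
proof -
  define H where "H = [V]\<^bsup>2\<^esup> - E"
  have sg: "simple_graph V H" using assms(1) by (auto simp: simple_graph_def H_def)
  have fin: "finite H" by (rule simple_graph_finite[OF sg])
  have "\<exists>v. e = {u, v} \<and> u \<in> V \<and> v \<in> V \<and> u \<noteq> v \<and> degree H u \<ge> 1 \<and> degree H v \<ge> 1"
    if e: "e \<in> H" "u \<in> e" for e u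
  proof -
    have "e \<in> [V]\<^bsup>2\<^esup>" using e(1) sg by (auto simp: simple_graph_def)
    then obtain a b where ab: "e = {a, b}" "a \<in> V" "b \<in> V" "a \<noteq> b" by (rule nsets2_E)
    then obtain v where v: "e = {u, v}" "u \<in> V" "v \<in> V" "u \<noteq> v" using e(2) by blast
    then show ?thesis using degree_pos[OF fin e(1)] by blast
  qed
  then show ?thesis
    using that[OF H_def sg fin] missing_degree_pair[OF assms] unfolding H_def by blast
qed

text \<open>The ends of an edge of H would have degree sum at least 2, where only 1 is
  allowed.\<close>

lemma missing_eq_empty:
  assumes "simple_graph V E" "2 * card V \<le> mp V E + 3"
  shows "E = [V]\<^bsup>2\<^esup>"
proof (rule ccontr)
  obtain H where H: "H = [V]\<^bsup>2\<^esup> - E"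
    and pair: "\<And>u v. u \<in> V \<Longrightarrow> v \<in> V \<Longrightarrow> u \<noteq> v \<Longrightarrow> degree H u + degree H v \<le> 0 + (if {u, v} \<in> H then 1 else 0)"
    and edge: "\<And>e u. e \<in> H \<Longrightarrow> u \<in> e \<Longrightarrow> \<exists>v. e = {u, v} \<and> u \<in> V \<and> v \<in> V \<and> u \<noteq> v \<and> degree H u \<ge> 1 \<and> degree H v \<ge> 1"
    using missing_edge_degrees[OF assms(1), of 0] assms(2) by auto
  assume "E \<noteq> [V]\<^bsup>2\<^esup>"
  then obtain e where e: "e \<in> H" using assms(1) by (auto simp: simple_graph_def H)
  moreover have "e \<noteq> {}" using e H by (auto elim!: nsets2_E)
  ultimately obtain u v where "e = {u, v}" "u \<in> V" "v \<in> V" "u \<noteq> v" "degree H u \<ge> 1" "degree H v \<ge> 1"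
    using edge by blast
  then show False using pair[of u v] by (simp split: if_splits)
qed

text \<open>Adjacent vertices of H have degree sum at most 2, so H is a matching. Two of its edges
  would provide non-adjacent vertices of degree 1 each, whose sum exceeds the bound 1.\<close>

lemma card_missing_le_1:
  assumes "simple_graph V E" "2 * card V \<le> mp V E + 4"
  shows "card ([V]\<^bsup>2\<^esup> - E) \<le> 1"
proof -
  obtain H where H: "H = [V]\<^bsup>2\<^esup> - E" and fin: "finite H"
    and pair: "\<And>u v. u \<in> V \<Longrightarrow> v \<in> V \<Longrightarrow> u \<noteq> v \<Longrightarrow> degree H u + degree H v \<le> 1 + (if {u, v} \<in> H then 1 else 0)"
    and edge: "\<And>e u. e \<in> H \<Longrightarrow> u \<in> e \<Longrightarrow> \<exists>v. e = {u, v} \<and> u \<in> V \<and> v \<in> V \<and> u \<noteq> v \<and> degree H u \<ge> 1 \<and> degree H v \<ge> 1"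
    using missing_edge_degrees[OF assms(1), of 1] assms(2) by auto
  have same: "g = h" if gh: "g \<in> H" "h \<in> H" "w \<in> g" "w \<in> h" for g h w
  proof -
    obtain v where v: "g = {w, v}" "w \<in> V" "v \<in> V" "w \<noteq> v" "degree H v \<ge> 1" using edge[OF gh(1,3)] by blast
    have "degree H w + degree H v \<le> 2" using pair[OF v(2-4)] by (simp split: if_splits)
    then have "card {e \<in> H. w \<in> e} \<le> Suc 0" using v(5) by (simp add: degree_def)
    moreover have "finite {e \<in> H. w \<in> e}" using fin by simp
    ultimately show ?thesis using gh by (simp add: card_le_Suc0_iff_eq)
  qed
  have "e = f" if ef: "e \<in> H" "f \<in> H" for e f
  proof (rule ccontr)
    assume "e \<noteq> f"
    have "e \<noteq> {}" "f \<noteq> {}" using ef H by (auto elim!: nsets2_E)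
    then obtain u w where uw: "u \<in> e" "w \<in> f" by blast
    have u: "u \<in> V" "degree H u \<ge> 1" using edge[OF ef(1) uw(1)] by blast+
    have w: "w \<in> V" "degree H w \<ge> 1" using edge[OF ef(2) uw(2)] by blast+
    have "u \<noteq> w" using same[OF ef] uw \<open>e \<noteq> f\<close> by blast
    moreover have "{u, w} \<notin> H"
    proof
      assume uwH: "{u, w} \<in> H"
      have "{u, w} = e" by (rule same[OF uwH ef(1) _ uw(1)]) simp
      moreover have "{u, w} = f" by (rule same[OF uwH ef(2) _ uw(2)]) simp
      ultimately show False using \<open>e \<noteq> f\<close> by simp
    qed
    ultimately show False using pair[OF u(1) w(1)] u w by simp
  qed
  then show ?thesis using card_le_Suc0_iff_eq[OF fin] H by simp
qed

text \<open>Either H is a matching, or some u has degree at least 2 in H. As u has a neighbour and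
  the sum is at most 3, its degree is 2; then only its two neighbours can have positive degree,
  namely 1, and H has at most two edges, which 4 \<le> n accommodates.\<close>

lemma card_missing_le_half:
  assumes "simple_graph V E" "2 * card V \<le> mp V E + 5" "card V \<ge> 4"
  shows "2 * card ([V]\<^bsup>2\<^esup> - E) \<le> card V"
proof -
  have finV: "finite V" using assms(1) by (simp add: simple_graph_def)
  obtain H where H: "H = [V]\<^bsup>2\<^esup> - E" and sg: "simple_graph V H"
    and pair: "\<And>u v. u \<in> V \<Longrightarrow> v \<in> V \<Longrightarrow> u \<noteq> v \<Longrightarrow> degree H u + degree H v \<le> 2 + (if {u, v} \<in> H then 1 else 0)"
    and edge: "\<And>e u. e \<in> H \<Longrightarrow> u \<in> e \<Longrightarrow> \<exists>v. e = {u, v} \<and> u \<in> V \<and> v \<in> V \<and> u \<noteq> v \<and> degree H u \<ge> 1 \<and> degree H v \<ge> 1"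
    using missing_edge_degrees[OF assms(1), of 2] assms(2) by auto
  have "2 * card H \<le> card V"
  proof (cases "\<exists>u\<in>V. degree H u \<ge> 2")
    case True
    then obtain u where u: "u \<in> V" "degree H u \<ge> 2" by blast
    have "{e \<in> H. u \<in> e} \<noteq> {}"
    proof
      assume "{e \<in> H. u \<in> e} = {}"
      then have "degree H u = 0" unfolding degree_def by (metis card.empty)
      then show False using u by simp
    qed
    then obtain v where v: "v \<in> V" "u \<noteq> v" "degree H v \<ge> 1" using edge by blast
    then have du: "degree H u = 2" using pair[OF u(1) v(1,2)] u(2) by (simp split: if_splits)
    have "(\<Sum>w\<in>V - {u}. degree H w) \<le> (\<Sum>w\<in>V - {u}. if {u, w} \<in> H then 1 else 0)"
    proof (rule sum_mono)
      fix w assume "w \<in> V - {u}"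
      then show "degree H w \<le> (if {u, w} \<in> H then 1 else 0)"
        using pair[OF u(1), of w] du by auto
    qed
    then have "(\<Sum>w\<in>V. degree H w) \<le> 4"
      using sum_adjacent[OF sg u(1)] sum.remove[OF finV u(1), of "degree H"] du by simp
    then show ?thesis using sum_degree[OF sg] assms(3) by simp
  next
    case False
    then have "degree H w \<le> 1" if "w \<in> V" for w using that by (auto simp: not_le)
    then have "(\<Sum>w\<in>V. degree H w) \<le> (\<Sum>w\<in>V. 1)" by (intro sum_mono)
    then show ?thesis using sum_degree[OF sg] by simp
  qed
  then show ?thesis using H by simp
qed

section \<open>The complete graph, and the complete graph minus a matching\<close>

lemma mp_complete_ge:
  assumes "finite V" "odd (card V)" "card V \<ge> 9"
  shows "2 * card V - 3 \<le> mp V ([V]\<^bsup>2\<^esup>)"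
proof (rule le_mpI)
  show K: "simple_graph V ([V]\<^bsup>2\<^esup>)" using assms(1) by (simp add: simple_graph_def)
  show "2 \<le> card V" using assms(3) by simp
  obtain p where p: "card V = 2 * p + 1" using assms(2) by (rule oddE)
  define m where "m = p - 1"
  have m: "card V = 2 * m + 3" "m \<ge> 3" using p assms(3) by (auto simp: m_def)
  fix F assume F: "F \<subseteq> [V]\<^bsup>2\<^esup>" "precluded V ([V]\<^bsup>2\<^esup> - F)"
  have "4 * m + 3 \<le> card ([V]\<^bsup>2\<^esup> - ([V]\<^bsup>2\<^esup> - F))"
    using m by (intro complete_missing_ge F(2) simple_graph_subset[OF K]) auto
  then show "2 * card V - 3 \<le> card F" using m F(1) by (simp add: double_diff)
qed

lemma mp_complete_Diff_matching_ge:
  assumes "finite V" "odd (card V)" "card V \<ge> 13" "disjoint H"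
  shows "2 * card V - 5 \<le> mp V ([V]\<^bsup>2\<^esup> - H)"
proof (rule le_mpI)
  show K: "simple_graph V ([V]\<^bsup>2\<^esup> - H)" using assms(1) by (auto simp: simple_graph_def)
  show "2 \<le> card V" using assms(3) by simp
  obtain p where p: "card V = 2 * p + 1" using assms(2) by (rule oddE)
  define m where "m = p - 1"
  have m: "card V = 2 * m + 3" "m \<ge> 5" using p assms(3) by (auto simp: m_def)
  fix F assume F: "F \<subseteq> [V]\<^bsup>2\<^esup> - H" "precluded V ([V]\<^bsup>2\<^esup> - H - F)"
  have "4 * m + 1 \<le> card ([V]\<^bsup>2\<^esup> - ([V]\<^bsup>2\<^esup> - H - F) - H)"
    using m assms(4) by (intro complete_missing_Diff_matching_ge F(2) simple_graph_subset[OF K]) auto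
  moreover have "[V]\<^bsup>2\<^esup> - ([V]\<^bsup>2\<^esup> - H - F) - H = F" using F(1) by blast
  ultimately show "2 * card V - 5 \<le> card F" using m by simp
qed

lemma min_size_ge_of_pairs:
  assumes "n \<ge> 3" "k \<le> mp {..<n} E" "simple_graph {..<n} E"
  shows "n * (n - 1) * k \<le> (4 * n - 6) * min_size n k"
proof -
  \<comment> \<open>The given graph E ensures that the minimum is attained; the inequality is then
    applied to a minimiser.\<close>
  obtain V' :: "nat set" and E' where E': "simple_graph V' E'" "card V' = n" "mp V' E' = k" "card E' = min_size n k"
    using min_size_attained[OF assms(3) _ _ assms(2)] assms(1) by auto
  have "n * (n - 1) * k + 4 * min_size n k \<le> (4 * n - 2) * min_size n k"
    using mp_card_edges_le[OF E'(1)] E' by simp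
  moreover have "(4 * n - 2) * min_size n k = (4 * n - 6) * min_size n k + 4 * min_size n k"
    using assms(1) by (simp add: algebra_simps diff_mult_distrib)
  ultimately show ?thesis by linarith
qed

lemma odd_graph_exists:
  assumes "odd n" "n \<ge> 5" "k \<le> 2 * n - 6"
  obtains E where "simple_graph {..<n} E" "k \<le> mp {..<n} E" "card E \<le> min ((k + 2) div 3) ((n - 1) div 2) * n"
proof -
  obtain m where n: "n = 2 * m + 1" using assms(1) by (rule oddE)
  let ?r = "(k + 2) div 3"
  show ?thesis
  proof (cases "?r \<le> m")
    case True
    obtain E where "simple_graph {..<n} E" "card E = ?r * n" "3 * ?r \<le> mp {..<n} E"
      using hamilton_union[OF _ True] n assms(2) by auto
    moreover have "k \<le> 3 * ?r" by linarith
    ultimately show ?thesis using True n by (intro that[of E]) auto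
  next
    case False
    \<comment> \<open>More cycles would be needed than the complete graph contains, so k exceeds 3m.
      Together with k \<le> 2n - 6 this rules out small orders, and \<open>mp_complete_ge\<close>
      applies.\<close>
    then have "n \<ge> 9" using assms(3) n by linarith
    then have "2 * n - 3 \<le> mp {..<n} ([{..<n}]\<^bsup>2\<^esup>)" using mp_complete_ge[of "{..<n}"] assms(1) by simp
    moreover have "card ([{..<n}]\<^bsup>2\<^esup>) = m * n" using card_complete[of "{..<n}"] n by simp
    ultimately show ?thesis using False n assms(3)
      by (intro that[of "[{..<n}]\<^bsup>2\<^esup>"]) (auto simp: simple_graph_def)
  qed
qed

lemma min_size_eqI:
  assumes "simple_graph {..<n} E" "k \<le> mp {..<n} E" "n \<ge> 2" "card E \<le> c"
    and "\<And>V E. simple_graph (V :: nat set) E \<Longrightarrow> card V = n \<Longrightarrow> mp V E = k \<Longrightarrow> c \<le> card E"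
  shows "min_size n k = c"
proof -
  obtain V' :: "nat set" and E' where "simple_graph V' E'" "card V' = n" "mp V' E' = k" "card E' = min_size n k"
    using min_size_attained[OF assms(1) _ assms(3,2)] by auto
  then have "c \<le> min_size n k" using assms(5) by metis
  moreover have "min_size n k \<le> c" using min_size_le[OF assms(1) _ assms(3,2)] assms(4) by simp
  ultimately show ?thesis by simp
qed

lemma min_size_large:
  assumes n: "n = 2 * m + 1" "n \<ge> 13"
  shows "min_size n (2 * n - 3) = m * n" "min_size n (2 * n - 4) = m * n - 1" "min_size n (2 * n - 5) = m * n - m"
proof -
  let ?V = "{..<n}" and ?K = "[{..<n}]\<^bsup>2\<^esup>"
  have K: "simple_graph ?V ?K" by (simp add: simple_graph_def)
  have mpK: "2 * n - 3 \<le> mp ?V ?K" using mp_complete_ge[of ?V] n by simp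
  have card_K: "card ([V]\<^bsup>2\<^esup>) = m * n" if "finite V" "card V = n" for V :: "nat set"
    using card_complete[OF that(1)] that(2) n by simp
  have card_compl: "card ([V]\<^bsup>2\<^esup> - E) = m * n - card E" if "simple_graph V E" "card V = n" for V :: "nat set" and E
    using that card_K[of V] simple_graph_finite[OF that(1)]
    by (subst card_Diff_subset) (auto simp: simple_graph_def)
  show "min_size n (2 * n - 3) = m * n"
  proof (rule min_size_eqI[OF K mpK])
    fix V :: "nat set" and E assume E: "simple_graph V E" "card V = n" "mp V E = 2 * n - 3"
    then have "E = [V]\<^bsup>2\<^esup>" using n by (intro missing_eq_empty) auto
    then show "m * n \<le> card E" using card_K[of V] E by (simp add: simple_graph_def)
  qed (use n card_K[of ?V] in simp_all)
  show "min_size n (2 * n - 4) = m * n - 1"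
  proof (rule min_size_eqI)
    show "simple_graph ?V (?K - {{0, 1}})" by (rule simple_graph_subset[OF K]) auto
    show "2 * n - 4 \<le> mp ?V (?K - {{0, 1}})" using mp_Diff_singleton_ge[OF K, of "{0, 1}"] mpK n by simp
    show "card (?K - {{0, 1}}) \<le> m * n - 1" using card_K[of ?V] n by (simp add: card_Diff_singleton_if)
    fix V :: "nat set" and E assume E: "simple_graph V E" "card V = n" "mp V E = 2 * n - 4"
    then have "card ([V]\<^bsup>2\<^esup> - E) \<le> 1" using n by (intro card_missing_le_1) auto
    then show "m * n - 1 \<le> card E" using card_compl[OF E(1,2)] by simp
  qed (use n in simp)
  obtain H where H: "disjoint H" "card H = m" "H \<subseteq> ?K"
    using near_perfect_matching_exists[of ?V m] n by auto
  show "min_size n (2 * n - 5) = m * n - m"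
  proof (rule min_size_eqI)
    show "simple_graph ?V (?K - H)" by (rule simple_graph_subset[OF K]) auto
    show "2 * n - 5 \<le> mp ?V (?K - H)" using mp_complete_Diff_matching_ge[of ?V H] H(1) n by simp
    have "finite H" using H(3) simple_graph_finite[OF K] by (rule finite_subset)
    then show "card (?K - H) \<le> m * n - m" using card_K[of ?V] H by (simp add: card_Diff_subset)
    fix V :: "nat set" and E assume E: "simple_graph V E" "card V = n" "mp V E = 2 * n - 5"
    then have "2 * card ([V]\<^bsup>2\<^esup> - E) \<le> card V" using n by (intro card_missing_le_half) auto
    \<comment> \<open>The bound n/2 on the missing edges rounds down to m because n = 2m + 1,
      matching the size of H.\<close>
    then have "m * n - card E \<le> m" using card_compl[OF E(1,2)] E(2) n(1) by linarith
    then show "m * n - m \<le> card E" by simp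
  qed (use n in simp)
qed

lemma min_size_small:
  assumes n: "n = 2 * m + 1" "n \<ge> 3"
  shows "min_size n 0 = 0" "min_size n 1 = m" "min_size n 2 = 2 * m" "min_size n 3 = n"
proof -
  let ?V = "{..<n}"
  have cV: "card ?V = n" "n \<ge> 2" using n by auto
  show "min_size n 0 = 0"
    by (rule min_size_eqI[of _ "{}"]) (use n in \<open>auto simp: simple_graph_def\<close>)
  obtain H where H: "disjoint H" "card H = m" "H \<subseteq> [?V]\<^bsup>2\<^esup>"
    using near_perfect_matching_exists[of ?V m] n by auto
  have sgH: "simple_graph ?V H" using H by (simp add: simple_graph_def)
  show "min_size n 1 = m"
  proof (rule min_size_eqI[OF sgH])
    have "mp ?V H \<noteq> 0"
    proof
      assume "mp ?V H = 0"
      then obtain F where F: "F \<subseteq> H" "card F = 0" "precluded ?V (H - F)"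
        using mp_witness[OF sgH] cV by metis
      then have "F = {}" using simple_graph_finite[OF sgH] by (metis card_0_eq finite_subset)
      then show False using F(3) not_precludedI[OF sgH order_refl H(1)] H(2) n by simp
    qed
    then show "1 \<le> mp ?V H" by simp
    fix V :: "nat set" and E assume "simple_graph V E" "card V = n" "mp V E = 1"
    then show "m \<le> card E" using card_le_of_mp_ge_1[of V E] n by simp
  qed (use n H in auto)
  obtain C where C: "simple_graph ?V C" "card C = n" "3 \<le> mp ?V C"
    using hamilton_union[of m 1] n by auto
  show "min_size n 3 = n"
  proof (rule min_size_eqI[OF C(1,3)])
    fix V :: "nat set" and E assume "simple_graph V E" "card V = n" "mp V E = 3"
    then show "n \<le> card E" using card_le_of_mp_ge_3[of V E] n by simp
  qed (use n C in auto)
  \<comment> \<open>A Hamilton cycle minus one edge is a path with n - 1 edges, and the deletion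
    lowers mp from at least 3 to no less than 2.\<close>
  obtain e where e: "e \<in> C" using C(2) n by fastforce
  show "min_size n 2 = 2 * m"
  proof (rule min_size_eqI)
    show "simple_graph ?V (C - {e})" by (rule simple_graph_subset[OF C(1)]) auto
    show "2 \<le> mp ?V (C - {e})" using mp_Diff_singleton_ge[OF C(1), of e] C(3) cV by simp
    show "card (C - {e}) \<le> 2 * m" using e C(2) n by simp
    fix V :: "nat set" and E assume "simple_graph V E" "card V = n" "mp V E = 2"
    then show "2 * m \<le> card E" using card_le_of_mp_ge_2[of V E] n by simp
  qed (use n in simp)
qed

lemma nat_ceiling_third: "\<lceil>real k / 3\<rceil> = int ((k + 2) div 3)"
proof (rule ceiling_unique)
  have "3 * ((k + 2) div 3) \<le> k + 2" "k \<le> 3 * ((k + 2) div 3)" by linarith+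
  then have "3 * real ((k + 2) div 3) \<le> real k + 2" "real k \<le> 3 * real ((k + 2) div 3)" by linarith+
  then show "real_of_int (int ((k + 2) div 3)) - 1 < real k / 3" "real k / 3 \<le> real_of_int (int ((k + 2) div 3))"
    by simp_all
qed

theorem theorem4p2:
  fixes n k :: nat
  shows "(n \<ge> 2 \<and> even n \<and> k \<le> n - 1 \<longrightarrow> real (min_size n k) = real n * real k / 2)
    \<and> (n \<ge> 5 \<and> odd n \<and> 4 \<le> k \<and> k \<le> 2 * n - 6 \<longrightarrow>
         real n * (real n - 1) * real k / (4 * real n - 6) \<le> real (min_size n k)
       \<and> real (min_size n k) \<le> min (real_of_int \<lceil>real k / 3\<rceil>) ((real n - 1) / 2) * real n)
    \<and> (n \<ge> 13 \<and> odd n \<longrightarrow>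
         real (min_size n (2 * n - 3)) = real n * (real n - 1) / 2
       \<and> real (min_size n (2 * n - 4)) = real n * (real n - 1) / 2 - 1
       \<and> real (min_size n (2 * n - 5)) = real n * (real n - 1) / 2 - (real n - 1) / 2
       \<and> min_size n 0 = 0
       \<and> real (min_size n 1) = (real n - 1) / 2
       \<and> real (min_size n 2) = real n - 1
       \<and> min_size n 3 = n)"
proof (intro conjI impI; (elim conjE)?)
  assume "2 \<le> n" "even n" "k \<le> n - 1"
  then have "2 * min_size n k = n * k" by (rule min_size_even)
  then have "2 * real (min_size n k) = real n * real k" by (metis of_nat_mult of_nat_numeral)
  then show "real (min_size n k) = real n * real k / 2" by simp
next
  assume a: "5 \<le> n" "odd n" "4 \<le> k" "k \<le> 2 * n - 6"
  obtain E where E: "simple_graph {..<n} E" "k \<le> mp {..<n} E"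
    "card E \<le> min ((k + 2) div 3) ((n - 1) div 2) * n"
    using odd_graph_exists[OF a(2,1,4)] .
  have "real (n * (n - 1) * k) \<le> real ((4 * n - 6) * min_size n k)"
    using min_size_ge_of_pairs[OF _ E(2,1)] a(1) by (intro of_nat_mono) simp
  then have "real n * (real n - 1) * real k \<le> (4 * real n - 6) * real (min_size n k)"
    using a(1) by (simp add: of_nat_diff)
  then show "real n * (real n - 1) * real k / (4 * real n - 6) \<le> real (min_size n k)"
    using a(1) by (simp add: divide_le_eq mult.commute)
  have "min_size n k \<le> min ((k + 2) div 3) ((n - 1) div 2) * n"
    using min_size_le[OF E(1) _ _ E(2)] E(3) a(1) by simp
  then have "real (min_size n k) \<le> real (min ((k + 2) div 3) ((n - 1) div 2) * n)"
    by (rule of_nat_mono)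
  also have "\<dots> = min (real ((k + 2) div 3)) (real ((n - 1) div 2)) * real n"
    by (simp only: of_nat_mult of_nat_min)
  also have "real ((n - 1) div 2) = (real n - 1) / 2"
    using a(2) by (auto elim!: oddE)
  also have "real ((k + 2) div 3) = real_of_int \<lceil>real k / 3\<rceil>"
    by (simp only: nat_ceiling_third of_int_of_nat_eq)
  finally show "real (min_size n k) \<le> min (real_of_int \<lceil>real k / 3\<rceil>) ((real n - 1) / 2) * real n" .
next
  assume n13: "13 \<le> n" and "odd n"
  then obtain m where n: "n = 2 * m + 1" by (auto elim: oddE)
  have m: "real m = (real n - 1) / 2" using n by simp
  have "m \<ge> 1" using n n13 by simp
  then have le: "1 \<le> m * n" "m \<le> m * n" using n by simp_all
  note large = min_size_large[OF n n13] and small = min_size_small[OF n]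
  show "real (min_size n (2 * n - 3)) = real n * (real n - 1) / 2"
    using large(1) m by simp
  show "real (min_size n (2 * n - 4)) = real n * (real n - 1) / 2 - 1"
    using large(2) m le(1) by (simp add: of_nat_diff)
  show "real (min_size n (2 * n - 5)) = real n * (real n - 1) / 2 - (real n - 1) / 2"
  proof -
    have "real (min_size n (2 * n - 5)) = real m * real n - real m"
      using large(3) le(2) by (simp add: of_nat_diff)
    then show ?thesis using m by (simp add: field_simps)
  qed
  show "min_size n 0 = 0" "min_size n 3 = n" using small(1,4) n13 by simp_all
  show "real (min_size n 1) = (real n - 1) / 2" using small(2) n13 m by simp
  show "real (min_size n 2) = real n - 1" using small(3) n13 n by simp
qed

end
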